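(* Let $\mathsf C$ and $\mathsf D$ be abelian categories and let $F\colon\mathsf C\to\mathsf D$ be an exact functor. a) $F$ respects projectivity if and only if $\mathrm{dp}(A)\geq\mathrm{dp}(F(A))$ for every object $A$ of $\mathsf C$. b) If an object $A$ of $\mathsf C$ has a projective resolution and $F$ respects and reflects projectivity, then $\mathrm{dp}(A)=\mathrm{dp}(F(A))$.
   Context: For an object $A$ of an abelian category, the projective dimension is $\mathrm{dp}(A):=\inf\{n\in\mathbb N\mid A\text{ has a projective resolution of length }n\}\in\mathbb N\cup\{\infty\}$, with $0\in\mathbb N$ and $\inf\emptyset=\infty$. A projective resolution of length $n$ is an exact sequence $0\to P_n\to\cdots\to P_0\to A\to 0$ with all $P_i$ projective. $F$ respects projectivity if $F(P)$ is projective for every projective object $P$ of $\mathsf C$; $F$ reflects projectivity if every object $P$ of $\mathsf C$ such that $F(P)$ is projective is itself projective. The categories are not assumed to have enough projectives. *)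

theory Defs
  imports "HOL-Algebra.Group" "HOL-Library.Extended_Nat"
begin

record ('o, 'm) category_data =
  Obj :: "'o set"
  Arr :: "'m set"
  Dom :: "'m \<Rightarrow> 'o"
  Cod :: "'m \<Rightarrow> 'o"
  Ide :: "'o \<Rightarrow> 'm"
  Comp :: "'m \<Rightarrow> 'm \<Rightarrow> 'm" (infixl "\<cdot>\<index>" 70)

definition Hom :: "('o, 'm, 'x) category_data_scheme \<Rightarrow> 'o \<Rightarrow> 'o \<Rightarrow> 'm set"
  where "Hom C A B = {f \<in> Arr C. Dom C f = A \<and> Cod C f = B}"

text \<open>Composition is written in the usual order: \<open>g \<cdot>\<^bsub>C\<^esub> f\<close> is \<open>g\<close> after \<open>f\<close>;
  its value is irrelevant unless \<open>f\<close> and \<open>g\<close> are composable.\<close>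

locale category =
  fixes C :: "('o, 'm, 'x) category_data_scheme" (structure)
  assumes Dom_Obj: "f \<in> Arr C \<Longrightarrow> Dom C f \<in> Obj C"
    and Cod_Obj: "f \<in> Arr C \<Longrightarrow> Cod C f \<in> Obj C"
    and Ide_Hom: "A \<in> Obj C \<Longrightarrow> Ide C A \<in> Hom C A A"
    and Comp_Hom: "\<lbrakk>f \<in> Hom C A B; g \<in> Hom C B D\<rbrakk> \<Longrightarrow> g \<cdot> f \<in> Hom C A D"
    and Comp_Ide: "f \<in> Hom C A B \<Longrightarrow> f \<cdot> Ide C A = f"
    and Ide_Comp: "f \<in> Hom C A B \<Longrightarrow> Ide C B \<cdot> f = f"
    and Comp_assoc: "\<lbrakk>f \<in> Hom C A B; g \<in> Hom C B D; h \<in> Hom C D E\<rbrakk>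
      \<Longrightarrow> h \<cdot> (g \<cdot> f) = (h \<cdot> g) \<cdot> f"

definition mono_arr :: "('o, 'm, 'x) category_data_scheme \<Rightarrow> 'm \<Rightarrow> bool"
  where "mono_arr C f \<longleftrightarrow> f \<in> Arr C \<and>
    (\<forall>A. \<forall>g \<in> Hom C A (Dom C f). \<forall>h \<in> Hom C A (Dom C f).
      f \<cdot>\<^bsub>C\<^esub> g = f \<cdot>\<^bsub>C\<^esub> h \<longrightarrow> g = h)"

definition epi_arr :: "('o, 'm, 'x) category_data_scheme \<Rightarrow> 'm \<Rightarrow> bool"
  where "epi_arr C f \<longleftrightarrow> f \<in> Arr C \<and>
    (\<forall>A. \<forall>g \<in> Hom C (Cod C f) A. \<forall>h \<in> Hom C (Cod C f) A.
      g \<cdot>\<^bsub>C\<^esub> f = h \<cdot>\<^bsub>C\<^esub> f \<longrightarrow> g = h)"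

definition zero_object :: "('o, 'm, 'x) category_data_scheme \<Rightarrow> 'o \<Rightarrow> bool"
  where "zero_object C Z \<longleftrightarrow> Z \<in> Obj C \<and>
    (\<forall>A \<in> Obj C. (\<exists>!f. f \<in> Hom C Z A) \<and> (\<exists>!f. f \<in> Hom C A Z))"

definition projective :: "('o, 'm, 'x) category_data_scheme \<Rightarrow> 'o \<Rightarrow> bool"
  where "projective C P \<longleftrightarrow> P \<in> Obj C \<and>
    (\<forall>A B e f. epi_arr C e \<and> e \<in> Hom C A B \<and> f \<in> Hom C P B
      \<longrightarrow> (\<exists>h \<in> Hom C P A. e \<cdot>\<^bsub>C\<^esub> h = f))"

record ('o, 'm) preadditive_data = "('o, 'm) category_data" +
  Add :: "'m \<Rightarrow> 'm \<Rightarrow> 'm"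
  Zero :: "'o \<Rightarrow> 'o \<Rightarrow> 'm"

definition Hom_group :: "('o, 'm, 'x) preadditive_data_scheme \<Rightarrow> 'o \<Rightarrow> 'o \<Rightarrow> 'm monoid"
  where "Hom_group C A B = \<lparr>carrier = Hom C A B, mult = Add C, one = Zero C A B\<rparr>"

locale preadditive_category = category C
  for C :: "('o, 'm, 'x) preadditive_data_scheme" (structure) +
  assumes Hom_comm_group: "\<lbrakk>A \<in> Obj C; B \<in> Obj C\<rbrakk> \<Longrightarrow> comm_group (Hom_group C A B)"
    and Comp_Add_left: "\<lbrakk>f \<in> Hom C A B; g \<in> Hom C B D; h \<in> Hom C B D\<rbrakk>
      \<Longrightarrow> Add C g h \<cdot> f = Add C (g \<cdot> f) (h \<cdot> f)"
    and Comp_Add_right: "\<lbrakk>f \<in> Hom C A B; g \<in> Hom C A B; h \<in> Hom C B D\<rbrakk>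
      \<Longrightarrow> h \<cdot> Add C f g = Add C (h \<cdot> f) (h \<cdot> g)"

definition has_biproduct :: "('o, 'm, 'x) preadditive_data_scheme \<Rightarrow> 'o \<Rightarrow> 'o \<Rightarrow> bool"
  where "has_biproduct C A B \<longleftrightarrow> (\<exists>S \<in> Obj C.
    \<exists>i \<in> Hom C A S. \<exists>j \<in> Hom C B S. \<exists>p \<in> Hom C S A. \<exists>q \<in> Hom C S B.
      p \<cdot>\<^bsub>C\<^esub> i = Ide C A \<and> q \<cdot>\<^bsub>C\<^esub> j = Ide C B \<and>
      q \<cdot>\<^bsub>C\<^esub> i = Zero C A B \<and> p \<cdot>\<^bsub>C\<^esub> j = Zero C B A \<and>
      Add C (i \<cdot>\<^bsub>C\<^esub> p) (j \<cdot>\<^bsub>C\<^esub> q) = Ide C S)"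

definition is_kernel :: "('o, 'm, 'x) preadditive_data_scheme \<Rightarrow> 'm \<Rightarrow> 'm \<Rightarrow> bool"
  where "is_kernel C k f \<longleftrightarrow> k \<in> Arr C \<and> f \<in> Arr C \<and> Cod C k = Dom C f \<and>
    f \<cdot>\<^bsub>C\<^esub> k = Zero C (Dom C k) (Cod C f) \<and>
    (\<forall>A. \<forall>g \<in> Hom C A (Dom C f). f \<cdot>\<^bsub>C\<^esub> g = Zero C A (Cod C f)
      \<longrightarrow> (\<exists>!h. h \<in> Hom C A (Dom C k) \<and> k \<cdot>\<^bsub>C\<^esub> h = g))"

definition is_cokernel :: "('o, 'm, 'x) preadditive_data_scheme \<Rightarrow> 'm \<Rightarrow> 'm \<Rightarrow> bool"
  where "is_cokernel C c f \<longleftrightarrow> c \<in> Arr C \<and> f \<in> Arr C \<and> Dom C c = Cod C f \<and>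
    c \<cdot>\<^bsub>C\<^esub> f = Zero C (Dom C f) (Cod C c) \<and>
    (\<forall>A. \<forall>g \<in> Hom C (Cod C f) A. g \<cdot>\<^bsub>C\<^esub> f = Zero C (Dom C f) A
      \<longrightarrow> (\<exists>!h. h \<in> Hom C (Cod C c) A \<and> h \<cdot>\<^bsub>C\<^esub> c = g))"

locale abelian_category = preadditive_category C
  for C :: "('o, 'm, 'x) preadditive_data_scheme" (structure) +
  assumes ex_zero_object: "\<exists>Z. zero_object C Z"
    and ex_biproduct: "\<lbrakk>A \<in> Obj C; B \<in> Obj C\<rbrakk> \<Longrightarrow> has_biproduct C A B"
    and ex_kernel: "f \<in> Arr C \<Longrightarrow> \<exists>k. is_kernel C k f"
    and ex_cokernel: "f \<in> Arr C \<Longrightarrow> \<exists>c. is_cokernel C c f"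
    and mono_is_kernel: "mono_arr C f \<Longrightarrow> \<exists>g. is_kernel C f g"
    and epi_is_cokernel: "epi_arr C f \<Longrightarrow> \<exists>g. is_cokernel C f g"

text \<open>The image of a morphism is the kernel of its cokernel. A pair \<open>A \<rightarrow> B \<rightarrow> D\<close> is exact at \<open>B\<close>
  if the image of the first morphism and the kernel of the second agree as subobjects of \<open>B\<close>,
  i.e. one morphism represents both.\<close>

definition is_image :: "('o, 'm, 'x) preadditive_data_scheme \<Rightarrow> 'm \<Rightarrow> 'm \<Rightarrow> bool"
  where "is_image C m f \<longleftrightarrow> (\<exists>c. is_cokernel C c f \<and> is_kernel C m c)"

definition exact_pair :: "('o, 'm, 'x) preadditive_data_scheme \<Rightarrow> 'm \<Rightarrow> 'm \<Rightarrow> bool"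
  where "exact_pair C f g \<longleftrightarrow> f \<in> Arr C \<and> g \<in> Arr C \<and> Cod C f = Dom C g \<and>
    (\<exists>m. is_image C m f \<and> is_kernel C m g)"

definition short_exact :: "('o, 'm, 'x) preadditive_data_scheme \<Rightarrow> 'm \<Rightarrow> 'm \<Rightarrow> bool"
  where "short_exact C f g \<longleftrightarrow> (\<exists>Z. zero_object C Z \<and>
    exact_pair C (Zero C Z (Dom C f)) f \<and> exact_pair C f g \<and>
    exact_pair C g (Zero C (Cod C g) Z))"

text \<open>In both kinds of resolution \<open>d 0\<close> is the augmentation \<open>P\<^sub>0 \<rightarrow> A\<close> and
  \<open>d (Suc i)\<close> is the differential \<open>P\<^sub>i\<^sub>+\<^sub>1 \<rightarrow> P\<^sub>i\<close>.\<close>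

definition has_projective_resolution_of_length ::
    "('o, 'm, 'x) preadditive_data_scheme \<Rightarrow> 'o \<Rightarrow> nat \<Rightarrow> bool"
  where "has_projective_resolution_of_length C A n \<longleftrightarrow>
    (\<exists>(P :: nat \<Rightarrow> 'o) (d :: nat \<Rightarrow> 'm) Z. zero_object C Z \<and>
      (\<forall>i \<le> n. projective C (P i)) \<and>
      d 0 \<in> Hom C (P 0) A \<and> (\<forall>i < n. d (Suc i) \<in> Hom C (P (Suc i)) (P i)) \<and>
      exact_pair C (Zero C Z (P n)) (d n) \<and>
      (\<forall>i < n. exact_pair C (d (Suc i)) (d i)) \<and>
      exact_pair C (d 0) (Zero C A Z))"

text \<open>A projective resolution without prescribed length is an exact sequence
  \<open>\<cdots> \<rightarrow> P\<^sub>1 \<rightarrow> P\<^sub>0 \<rightarrow> A \<rightarrow> 0\<close>. Resolutions of finite length are included, since they can be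
  continued to the left by zero objects.\<close>

definition has_projective_resolution ::
    "('o, 'm, 'x) preadditive_data_scheme \<Rightarrow> 'o \<Rightarrow> bool"
  where "has_projective_resolution C A \<longleftrightarrow>
    (\<exists>(P :: nat \<Rightarrow> 'o) (d :: nat \<Rightarrow> 'm) Z. zero_object C Z \<and>
      (\<forall>i. projective C (P i)) \<and>
      d 0 \<in> Hom C (P 0) A \<and> (\<forall>i. d (Suc i) \<in> Hom C (P (Suc i)) (P i)) \<and>
      (\<forall>i. exact_pair C (d (Suc i)) (d i)) \<and>
      exact_pair C (d 0) (Zero C A Z))"

definition dp :: "('o, 'm, 'x) preadditive_data_scheme \<Rightarrow> 'o \<Rightarrow> enat"
  where "dp C A = Inf {enat n | n. has_projective_resolution_of_length C A n}"

lemma dp_eq_infinity: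
  assumes "\<nexists>n. has_projective_resolution_of_length C A n"
  shows "dp C A = \<infinity>"
  using assms by (simp add: dp_def Inf_enat_def)

record ('o, 'm, 'p, 'n) functor_data =
  fobj :: "'o \<Rightarrow> 'p"
  farr :: "'m \<Rightarrow> 'n"

locale cat_functor = source: category C + target: category D
  for C :: "('o, 'm, 'x) category_data_scheme"
    and D :: "('p, 'n, 'y) category_data_scheme"
    and F :: "('o, 'm, 'p, 'n) functor_data" +
  assumes fobj_Obj: "A \<in> Obj C \<Longrightarrow> fobj F A \<in> Obj D"
    and farr_Hom: "f \<in> Hom C A B \<Longrightarrow> farr F f \<in> Hom D (fobj F A) (fobj F B)"
    and farr_Ide: "A \<in> Obj C \<Longrightarrow> farr F (Ide C A) = Ide D (fobj F A)"
    and farr_Comp: "\<lbrakk>f \<in> Hom C A B; g \<in> Hom C B E\<rbrakk>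
      \<Longrightarrow> farr F (g \<cdot>\<^bsub>C\<^esub> f) = farr F g \<cdot>\<^bsub>D\<^esub> farr F f"

text \<open>Additivity is not required: a functor between abelian categories that preserves short
  exact sequences is automatically additive.\<close>

locale exact_functor = cat_functor C D F
  for C :: "('o, 'm, 'x) preadditive_data_scheme"
    and D :: "('p, 'n, 'y) preadditive_data_scheme"
    and F :: "('o, 'm, 'p, 'n) functor_data" +
  assumes farr_short_exact: "short_exact C f g \<Longrightarrow> short_exact D (farr F f) (farr F g)"

definition respects_projectivity ::
    "('o, 'm, 'x) category_data_scheme \<Rightarrow> ('p, 'n, 'y) category_data_scheme \<Rightarrow>
      ('o, 'm, 'p, 'n) functor_data \<Rightarrow> bool"
  where "respects_projectivity C D F \<longleftrightarrow>
    (\<forall>P \<in> Obj C. projective C P \<longrightarrow> projective D (fobj F P))"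

definition reflects_projectivity ::
    "('o, 'm, 'x) category_data_scheme \<Rightarrow> ('p, 'n, 'y) category_data_scheme \<Rightarrow>
      ('o, 'm, 'p, 'n) functor_data \<Rightarrow> bool"
  where "reflects_projectivity C D F \<longleftrightarrow>
    (\<forall>P \<in> Obj C. projective D (fobj F P) \<longrightarrow> projective C P)"

end

theory Submission
  imports Defs
begin

text \<open>
  A projective resolution of length \<open>n\<close> is the same as \<open>n\<close> short exact sequences
  \<open>0 \<rightarrow> K\<^sub>i\<^sub>+\<^sub>1 \<rightarrow> P\<^sub>i \<rightarrow> K\<^sub>i \<rightarrow> 0\<close> with \<open>K\<^sub>0 = A\<close> and projective \<open>P\<^sub>i\<close>, the last syzygy \<open>K\<^sub>n\<close> being
  itself projective. The predicate \<open>pd_at_most\<close> records this recursively, and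
  \<open>resolution_of_length_iff\<close> shows that it agrees with the existence of a long exact sequence.
  In this form the preservation of short exact sequences by \<open>F\<close> suffices: if \<open>F\<close> respects
  projectivity, it carries the syzygies of \<open>A\<close> to syzygies of \<open>F A\<close>, so that
  \<open>dp (F A) \<le> dp A\<close>. Conversely, an object has dimension \<open>0\<close> if and only if it is projective, so
  the inequality for a projective \<open>P\<close> says that \<open>F P\<close> is projective.

  For the reverse inequality in part b), suppose that \<open>F A\<close> has dimension at most \<open>n\<close>, and take the
  syzygies \<open>K\<^sub>i\<close> of an arbitrary projective resolution of \<open>A\<close>. By Schanuel's lemma the number
  of further steps needed drops by one along \<^emph>\<open>every\<close> short exact sequence with projective middle
  term (\<open>pd_at_most_kernel\<close>), and not only along a sequence that stems from a shortest
  resolution. Applied to the sequences \<open>0 \<rightarrow> F K\<^sub>i\<^sub>+\<^sub>1 \<rightarrow> F P\<^sub>i \<rightarrow> F K\<^sub>i \<rightarrow> 0\<close>, this makes \<open>F K\<^sub>n\<close> projective.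
  As \<open>F\<close> reflects projectivity, \<open>K\<^sub>n\<close> is projective, and the resolution of \<open>A\<close> can be cut off
  there.

  Since the objects to be split off are projective, all epimorphisms that occur in the Schanuel
  argument either split or are visibly epimorphisms. It therefore takes place almost entirely in
  a preadditive category with biproducts and kernels; monomorphisms being kernels and
  epimorphisms being cokernels is used to factor morphisms through their images, that is, to
  translate exactness at an object into the form \<open>f = m h\<close> with \<open>h\<close> epi and \<open>m\<close> a kernel of \<open>g\<close>
  (\<open>exact_pair_iff\<close>).
\<close>

section \<open>Morphisms and projective objects in a category\<close>

text \<open>Typing by \<open>Dom\<close> and \<open>Cod\<close> equations instead of membership in a \<open>Hom\<close> set lets
  the simplifier compute types without having to guess intermediate objects.\<close>

lemma Hom_iff [simp]: "f \<in> Hom C A B \<longleftrightarrow> f \<in> Arr C \<and> Dom C f = A \<and> Cod C f = B"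
  by (simp add: Hom_def)

context category
begin

lemma Ide_simps [simp]:
  assumes "A \<in> Obj C"
  shows "Ide C A \<in> Arr C" "Dom C (Ide C A) = A" "Cod C (Ide C A) = A"
  using Ide_Hom [OF assms] by simp_all

lemma Comp_simps [simp]:
  assumes "f \<in> Arr C" "g \<in> Arr C" "Dom C g = Cod C f"
  shows "g \<cdot> f \<in> Arr C" "Dom C (g \<cdot> f) = Dom C f" "Cod C (g \<cdot> f) = Cod C g"
  using Comp_Hom [of f "Dom C f" "Cod C f" g "Cod C g"] assms by simp_all

lemma Comp_Ide_simps [simp]:
  assumes "f \<in> Arr C"
  shows "Dom C f = A \<Longrightarrow> f \<cdot> Ide C A = f" "Cod C f = A \<Longrightarrow> Ide C A \<cdot> f = f"
  using Comp_Ide [of f "Dom C f" "Cod C f"] Ide_Comp [of f "Dom C f" "Cod C f"] assms by auto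

lemma Comp_reassoc [simp]:
  assumes "f \<in> Arr C" "g \<in> Arr C" "h \<in> Arr C" "Dom C g = Cod C f" "Dom C h = Cod C g"
  shows "(h \<cdot> g) \<cdot> f = h \<cdot> (g \<cdot> f)"
  using Comp_assoc [of f "Dom C f" "Cod C f" g "Cod C g" h "Cod C h"] assms by simp

text \<open>With composition normalised to the right, an equation \<open>h g = k\<close> is visible inside
  \<open>h (g f)\<close> only in this form.\<close>

lemma Comp_eq_reassoc:
  assumes "h \<cdot> g = k" "f \<in> Arr C" "g \<in> Arr C" "h \<in> Arr C" "Dom C g = Cod C f" "Dom C h = Cod C g"
  shows "h \<cdot> (g \<cdot> f) = k \<cdot> f"
  using Comp_reassoc [OF assms(2-)] assms(1) by simp

declare Dom_Obj [simp] Cod_Obj [simp]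

lemma mono_arrD:
  assumes "mono_arr C f" "g \<in> Arr C" "h \<in> Arr C" "Cod C g = Dom C f" "Cod C h = Dom C f"
    "Dom C g = Dom C h" "f \<cdot> g = f \<cdot> h"
  shows "g = h"
  using assms by (auto simp: mono_arr_def)

lemma epi_arrD:
  assumes "epi_arr C f" "g \<in> Arr C" "h \<in> Arr C" "Dom C g = Cod C f" "Dom C h = Cod C f"
    "Cod C g = Cod C h" "g \<cdot> f = h \<cdot> f"
  shows "g = h"
  using assms by (auto simp: epi_arr_def)

lemma epi_arr_Comp:
  assumes "epi_arr C f" "epi_arr C g" "Dom C g = Cod C f"
  shows "epi_arr C (g \<cdot> f)"
proof -
  have [simp]: "f \<in> Arr C" "g \<in> Arr C" using assms by (auto simp: epi_arr_def)
  show ?thesis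
    unfolding epi_arr_def
  proof (intro conjI allI ballI impI)
    show "g \<cdot> f \<in> Arr C" using assms by simp
    fix A a b
    assume "a \<in> Hom C (Cod C (g \<cdot> f)) A" "b \<in> Hom C (Cod C (g \<cdot> f)) A" "a \<cdot> (g \<cdot> f) = b \<cdot> (g \<cdot> f)"
    then show "a = b"
      using assms by (auto intro!: epi_arrD [OF assms(2), of a b] epi_arrD [OF assms(1), of "a \<cdot> g" "b \<cdot> g"])
  qed
qed

lemma split_epi_arr:
  assumes [simp]: "f \<in> Arr C" "g \<in> Arr C" "Dom C f = Cod C g" and fg: "f \<cdot> g = Ide C (Cod C f)"
  shows "epi_arr C f"
  unfolding epi_arr_def
proof (intro conjI allI ballI impI)
  fix A a b
  assume a: "a \<in> Hom C (Cod C f) A" and b: "b \<in> Hom C (Cod C f) A" and eq: "a \<cdot> f = b \<cdot> f"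
  have "a \<cdot> (f \<cdot> g) = b \<cdot> (f \<cdot> g)"
    using a b Comp_eq_reassoc [OF eq, of g] by simp
  then show "a = b" using a b by (simp add: fg)
qed simp

lemma projectiveD:
  assumes "projective C P" "epi_arr C e" "f \<in> Arr C" "Dom C f = P" "Cod C f = Cod C e"
  obtains h where "h \<in> Arr C" "Dom C h = P" "Cod C h = Dom C e" "e \<cdot> h = f"
proof -
  have "e \<in> Hom C (Dom C e) (Cod C e)" "f \<in> Hom C P (Cod C e)"
    using assms by (auto simp: epi_arr_def)
  with assms have "\<exists>h \<in> Hom C P (Dom C e). e \<cdot> h = f"
    unfolding projective_def by blast
  with that show ?thesis by auto
qed

lemma projective_retract:
  assumes P: "projective C P" and [simp]: "i \<in> Arr C" "p \<in> Arr C" "Dom C p = P" "Cod C i = P"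
    and pi: "p \<cdot> i = Ide C (Dom C i)" and [simp]: "Cod C p = Dom C i"
  shows "projective C (Dom C i)"
  unfolding projective_def
proof (intro conjI allI impI)
  fix A B e f
  assume A: "epi_arr C e \<and> e \<in> Hom C A B \<and> f \<in> Hom C (Dom C i) B"
  obtain h where h [simp]: "h \<in> Arr C" "Dom C h = P" "Cod C h = Dom C e" "e \<cdot> h = f \<cdot> p"
    by (rule projectiveD [OF P, of e "f \<cdot> p"]) (use A in auto)
  have "e \<cdot> (h \<cdot> i) = f"
    using A Comp_eq_reassoc [OF h(4), of i] by (simp add: pi)
  then show "\<exists>h \<in> Hom C (Dom C i) A. e \<cdot> h = f"
    using A by (intro bexI [of _ "h \<cdot> i"]) auto
qed simp

end

section \<open>Kernels and biproducts in a preadditive category\<close>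

text \<open>The condition inside \<open>has_biproduct\<close>, with the object and the four morphisms named.\<close>

definition biproduct ::
    "('o, 'm, 'x) preadditive_data_scheme \<Rightarrow> 'o \<Rightarrow> 'o \<Rightarrow> 'o \<Rightarrow> 'm \<Rightarrow> 'm \<Rightarrow> 'm \<Rightarrow> 'm \<Rightarrow> bool"
  where "biproduct C S A B i j p q \<longleftrightarrow> S \<in> Obj C \<and>
    i \<in> Hom C A S \<and> j \<in> Hom C B S \<and> p \<in> Hom C S A \<and> q \<in> Hom C S B \<and>
    p \<cdot>\<^bsub>C\<^esub> i = Ide C A \<and> q \<cdot>\<^bsub>C\<^esub> j = Ide C B \<and>
    q \<cdot>\<^bsub>C\<^esub> i = Zero C A B \<and> p \<cdot>\<^bsub>C\<^esub> j = Zero C B A \<and>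
    Add C (i \<cdot>\<^bsub>C\<^esub> p) (j \<cdot>\<^bsub>C\<^esub> q) = Ide C S"

context preadditive_category
begin

lemma Zero_simps [simp]:
  assumes "A \<in> Obj C" "B \<in> Obj C"
  shows "Zero C A B \<in> Arr C" "Dom C (Zero C A B) = A" "Cod C (Zero C A B) = B"
proof -
  interpret comm_group "Hom_group C A B" using assms by (rule Hom_comm_group)
  from one_closed show "Zero C A B \<in> Arr C" "Dom C (Zero C A B) = A" "Cod C (Zero C A B) = B"
    by (simp_all add: Hom_group_def)
qed

lemma Add_simps [simp]:
  assumes "f \<in> Arr C" "g \<in> Arr C" "Dom C f = Dom C g" "Cod C f = Cod C g"
  shows "Add C f g \<in> Arr C" "Dom C (Add C f g) = Dom C g" "Cod C (Add C f g) = Cod C g"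
proof -
  interpret comm_group "Hom_group C (Dom C g) (Cod C g)"
    using assms by (auto intro: Hom_comm_group)
  from m_closed [of f g]
  show "Add C f g \<in> Arr C" "Dom C (Add C f g) = Dom C g" "Cod C (Add C f g) = Cod C g"
    using assms by (simp_all add: Hom_group_def)
qed

lemma Add_Zero [simp]:
  assumes "f \<in> Arr C" "Dom C f = A" "Cod C f = B"
  shows "Add C f (Zero C A B) = f" "Add C (Zero C A B) f = f"
proof -
  interpret comm_group "Hom_group C A B" using assms by (auto intro: Hom_comm_group)
  from r_one [of f] l_one [of f]
  show "Add C f (Zero C A B) = f" "Add C (Zero C A B) f = f"
    using assms by (simp_all add: Hom_group_def)
qed

lemma Add_right_cancel:
  assumes "f \<in> Arr C" "g \<in> Arr C" "h \<in> Arr C"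
    "Dom C f = Dom C h" "Dom C g = Dom C h" "Cod C f = Cod C h" "Cod C g = Cod C h"
    "Add C f h = Add C g h"
  shows "f = g"
proof -
  interpret comm_group "Hom_group C (Dom C h) (Cod C h)"
    using assms by (auto intro: Hom_comm_group)
  from right_cancel [of h f g] show ?thesis
    using assms by (simp add: Hom_group_def)
qed

text \<open>Subtraction enters only through this lemma; all equations are then stated with \<open>Add\<close> and
  solved by cancellation, which avoids group inverses.\<close>

lemma ex_difference:
  assumes "f \<in> Arr C" "g \<in> Arr C" "Dom C f = Dom C g" "Cod C f = Cod C g"
  obtains d where "d \<in> Arr C" "Dom C d = Dom C g" "Cod C d = Cod C g" "Add C d g = f"
proof -
  interpret comm_group "Hom_group C (Dom C g) (Cod C g)"
    using assms by (auto intro: Hom_comm_group)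
  let ?d = "f \<otimes>\<^bsub>Hom_group C (Dom C g) (Cod C g)\<^esub> inv\<^bsub>Hom_group C (Dom C g) (Cod C g)\<^esub> g"
  have fg: "f \<in> carrier (Hom_group C (Dom C g) (Cod C g))" "g \<in> carrier (Hom_group C (Dom C g) (Cod C g))"
    using assms by (simp_all add: Hom_group_def)
  then have "?d \<in> carrier (Hom_group C (Dom C g) (Cod C g))"
    and "?d \<otimes>\<^bsub>Hom_group C (Dom C g) (Cod C g)\<^esub> g = f"
    by (simp_all add: m_assoc)
  then show ?thesis using that [of ?d] by (simp add: Hom_group_def)
qed

lemma Comp_Add_simps [simp]:
  assumes "g \<in> Arr C" "h \<in> Arr C" "Dom C g = Dom C h" "Cod C g = Cod C h" "f \<in> Arr C"
  shows "Dom C h = Cod C f \<Longrightarrow> Add C g h \<cdot> f = Add C (g \<cdot> f) (h \<cdot> f)"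
    and "Dom C f = Cod C h \<Longrightarrow> f \<cdot> Add C g h = Add C (f \<cdot> g) (f \<cdot> h)"
  using assms Comp_Add_left [of f "Dom C f" "Cod C f" g "Cod C h" h]
    Comp_Add_right [of g "Dom C h" "Cod C h" h f "Cod C f"] by auto

lemma idem_Zero:
  assumes "f \<in> Arr C" "Add C f f = f"
  shows "f = Zero C (Dom C f) (Cod C f)"
  using assms by (auto intro!: Add_right_cancel [of f _ f])

lemma Comp_Zero [simp]:
  assumes [simp]: "f \<in> Arr C" "A \<in> Obj C"
  shows "B = Dom C f \<Longrightarrow> f \<cdot> Zero C A B = Zero C A (Cod C f)"
    and "B = Cod C f \<Longrightarrow> Zero C B A \<cdot> f = Zero C (Dom C f) A"
proof -
  assume [simp]: "B = Dom C f"
  have "Add C (f \<cdot> Zero C A B) (f \<cdot> Zero C A B) = f \<cdot> Add C (Zero C A B) (Zero C A B)"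
    by (subst Comp_Add_simps) simp_all
  then show "f \<cdot> Zero C A B = Zero C A (Cod C f)"
    using idem_Zero [of "f \<cdot> Zero C A B"] by simp
next
  assume [simp]: "B = Cod C f"
  have "Add C (Zero C B A \<cdot> f) (Zero C B A \<cdot> f) = Add C (Zero C B A) (Zero C B A) \<cdot> f"
    by (subst Comp_Add_simps) simp_all
  then show "Zero C B A \<cdot> f = Zero C (Dom C f) A"
    using idem_Zero [of "Zero C B A \<cdot> f"] by simp
qed

lemma mono_arrI:
  assumes f: "f \<in> Arr C"
    and "\<And>x. \<lbrakk>x \<in> Arr C; Cod C x = Dom C f; f \<cdot> x = Zero C (Dom C x) (Cod C f)\<rbrakk>
      \<Longrightarrow> x = Zero C (Dom C x) (Dom C f)"
  shows "mono_arr C f"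
  unfolding mono_arr_def
proof (intro conjI allI ballI impI)
  fix A a b
  assume a: "a \<in> Hom C A (Dom C f)" and b: "b \<in> Hom C A (Dom C f)" and eq: "f \<cdot> a = f \<cdot> b"
  then have [simp]: "A \<in> Obj C" by auto
  obtain d where d: "d \<in> Arr C" "Dom C d = A" "Cod C d = Dom C f" "Add C d b = a"
    by (rule ex_difference [of a b]) (use a b in auto)
  have "Add C (f \<cdot> d) (f \<cdot> b) = f \<cdot> Add C d b"
    using f b d(1-3) by simp
  also have "\<dots> = Add C (Zero C A (Cod C f)) (f \<cdot> b)"
    unfolding d(4) eq using f b by simp
  finally have "Add C (f \<cdot> d) (f \<cdot> b) = Add C (Zero C A (Cod C f)) (f \<cdot> b)" .
  then have "f \<cdot> d = Zero C A (Cod C f)"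
    using f b d by (auto intro!: Add_right_cancel [of "f \<cdot> d" _ "f \<cdot> b"])
  then have "d = Zero C A (Dom C f)" using assms(2) [of d] d by simp
  with d b show "a = b" by simp
qed (rule f)

lemma epi_arrI:
  assumes f: "f \<in> Arr C"
    and "\<And>x. \<lbrakk>x \<in> Arr C; Dom C x = Cod C f; x \<cdot> f = Zero C (Dom C f) (Cod C x)\<rbrakk>
      \<Longrightarrow> x = Zero C (Cod C f) (Cod C x)"
  shows "epi_arr C f"
  unfolding epi_arr_def
proof (intro conjI allI ballI impI)
  fix A a b
  assume a: "a \<in> Hom C (Cod C f) A" and b: "b \<in> Hom C (Cod C f) A" and eq: "a \<cdot> f = b \<cdot> f"
  then have [simp]: "A \<in> Obj C" by auto
  obtain d where d: "d \<in> Arr C" "Dom C d = Cod C f" "Cod C d = A" "Add C d b = a"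
    by (rule ex_difference [of a b]) (use a b in auto)
  have "Add C (d \<cdot> f) (b \<cdot> f) = Add C d b \<cdot> f"
    using f b d(1-3) by simp
  also have "\<dots> = Add C (Zero C (Dom C f) A) (b \<cdot> f)"
    unfolding d(4) eq using f b by simp
  finally have "Add C (d \<cdot> f) (b \<cdot> f) = Add C (Zero C (Dom C f) A) (b \<cdot> f)" .
  then have "d \<cdot> f = Zero C (Dom C f) A"
    using f b d by (auto intro!: Add_right_cancel [of "d \<cdot> f" _ "b \<cdot> f"])
  then have "d = Zero C (Cod C f) A" using assms(2) [of d] d by simp
  with d b show "a = b" by simp
qed (rule f)

lemma is_kernel_simps:
  assumes "is_kernel C k f"
  shows "k \<in> Arr C" "f \<in> Arr C" "Cod C k = Dom C f" "f \<cdot> k = Zero C (Dom C k) (Cod C f)"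
  using assms by (simp_all add: is_kernel_def)

lemma is_kernel_factor:
  assumes "is_kernel C k f" "g \<in> Arr C" "Cod C g = Dom C f" "f \<cdot> g = Zero C (Dom C g) (Cod C f)"
  obtains h where "h \<in> Arr C" "Dom C h = Dom C g" "Cod C h = Dom C k" "k \<cdot> h = g"
proof -
  have "g \<in> Hom C (Dom C g) (Dom C f)" using assms by simp
  with assms have "\<exists>!h. h \<in> Hom C (Dom C g) (Dom C k) \<and> k \<cdot> h = g"
    unfolding is_kernel_def by blast
  with that show ?thesis by auto
qed

lemma is_kernel_mono:
  assumes "is_kernel C k f"
  shows "mono_arr C k"
proof (rule mono_arrI)
  note [simp] = is_kernel_simps [OF assms]
  show "k \<in> Arr C" by simp
  fix x assume x: "x \<in> Arr C" "Cod C x = Dom C k" "k \<cdot> x = Zero C (Dom C x) (Cod C k)"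
  have "\<exists>!h. h \<in> Hom C (Dom C x) (Dom C k) \<and> k \<cdot> h = Zero C (Dom C x) (Dom C f)"
    using assms x unfolding is_kernel_def by simp
  moreover have "x \<in> Hom C (Dom C x) (Dom C k) \<and> k \<cdot> x = Zero C (Dom C x) (Dom C f)"
    using x by simp
  moreover have "Zero C (Dom C x) (Dom C k) \<in> Hom C (Dom C x) (Dom C k) \<and>
      k \<cdot> Zero C (Dom C x) (Dom C k) = Zero C (Dom C x) (Dom C f)"
    using x by simp
  ultimately show "x = Zero C (Dom C x) (Dom C k)" by blast
qed

lemma is_kernelI:
  assumes "mono_arr C k" "f \<in> Arr C" "Cod C k = Dom C f"
    and "f \<cdot> k = Zero C (Dom C k) (Cod C f)"
    and "\<And>x. \<lbrakk>x \<in> Arr C; Cod C x = Dom C f; f \<cdot> x = Zero C (Dom C x) (Cod C f)\<rbrakk>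
      \<Longrightarrow> \<exists>h \<in> Hom C (Dom C x) (Dom C k). k \<cdot> h = x"
  shows "is_kernel C k f"
  unfolding is_kernel_def
proof (intro conjI allI ballI impI)
  fix A g
  assume "g \<in> Hom C A (Dom C f)" "f \<cdot> g = Zero C A (Cod C f)"
  then obtain h where h: "h \<in> Hom C A (Dom C k)" "k \<cdot> h = g" using assms(5) [of g] by auto
  moreover have "h' = h" if "h' \<in> Hom C A (Dom C k) \<and> k \<cdot> h' = g" for h'
    by (rule mono_arrD [OF assms(1)]) (use that h in auto)
  ultimately show "\<exists>!h. h \<in> Hom C A (Dom C k) \<and> k \<cdot> h = g" by blast
qed (use assms(1-4) in \<open>simp_all add: mono_arr_def\<close>)

lemma is_cokernel_simps:
  assumes "is_cokernel C c f"
  shows "c \<in> Arr C" "f \<in> Arr C" "Dom C c = Cod C f" "c \<cdot> f = Zero C (Dom C f) (Cod C c)"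
  using assms by (simp_all add: is_cokernel_def)

lemma is_cokernel_factor:
  assumes "is_cokernel C c f" "g \<in> Arr C" "Dom C g = Cod C f" "g \<cdot> f = Zero C (Dom C f) (Cod C g)"
  obtains h where "h \<in> Arr C" "Dom C h = Cod C c" "Cod C h = Cod C g" "h \<cdot> c = g"
proof -
  have "g \<in> Hom C (Cod C f) (Cod C g)" using assms by simp
  with assms have "\<exists>!h. h \<in> Hom C (Cod C c) (Cod C g) \<and> h \<cdot> c = g"
    unfolding is_cokernel_def by blast
  with that show ?thesis by auto
qed

lemma biproduct_simps:
  assumes "biproduct C S A B i j p q"
  shows "S \<in> Obj C" "i \<in> Arr C" "j \<in> Arr C" "p \<in> Arr C" "q \<in> Arr C"
    "Dom C i = A" "Cod C i = S" "Dom C j = B" "Cod C j = S"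
    "Dom C p = S" "Cod C p = A" "Dom C q = S" "Cod C q = B"
    "p \<cdot> i = Ide C A" "q \<cdot> j = Ide C B" "q \<cdot> i = Zero C A B" "p \<cdot> j = Zero C B A"
    "Add C (i \<cdot> p) (j \<cdot> q) = Ide C S" "A \<in> Obj C" "B \<in> Obj C"
proof -
  from assms have "Dom C i \<in> Obj C" "Dom C i = A" "Dom C j \<in> Obj C" "Dom C j = B"
    unfolding biproduct_def Hom_iff by (blast intro: Dom_Obj)+
  then show "A \<in> Obj C" "B \<in> Obj C" by simp_all
qed (use assms in \<open>unfold biproduct_def Hom_iff, blast+\<close>)

lemma biproduct_decomp_to:
  assumes "biproduct C S A B i j p q" "f \<in> Arr C" "Cod C f = S"
  shows "Add C (i \<cdot> (p \<cdot> f)) (j \<cdot> (q \<cdot> f)) = f"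
proof -
  note [simp] = biproduct_simps [OF assms(1)]
  have "Add C (i \<cdot> (p \<cdot> f)) (j \<cdot> (q \<cdot> f)) = Add C (i \<cdot> p) (j \<cdot> q) \<cdot> f"
    using assms(2,3) by (subst Comp_Add_simps) simp_all
  also have "\<dots> = f" using assms(2,3) by simp
  finally show ?thesis .
qed

lemma biproduct_decomp_from:
  assumes "biproduct C S A B i j p q" "f \<in> Arr C" "Dom C f = S"
  shows "Add C ((f \<cdot> i) \<cdot> p) ((f \<cdot> j) \<cdot> q) = f"
proof -
  note [simp] = biproduct_simps [OF assms(1)]
  have "Add C ((f \<cdot> i) \<cdot> p) ((f \<cdot> j) \<cdot> q) = f \<cdot> Add C (i \<cdot> p) (j \<cdot> q)"
    using assms(2,3) by (subst Comp_Add_simps) simp_all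
  also have "\<dots> = f" using assms(2,3) by simp
  finally show ?thesis .
qed

lemma projective_biproduct:
  assumes bp: "biproduct C S A B i j p q" and "projective C A" "projective C B"
  shows "projective C S"
  unfolding projective_def
proof (intro conjI allI impI)
  note [simp] = biproduct_simps [OF bp]
  show "S \<in> Obj C" by simp
  fix X Y e f
  assume A: "epi_arr C e \<and> e \<in> Hom C X Y \<and> f \<in> Hom C S Y"
  obtain a where a: "a \<in> Arr C" "Dom C a = A" "Cod C a = X" "e \<cdot> a = f \<cdot> i"
    by (rule projectiveD [OF assms(2), of e "f \<cdot> i"]) (use A in auto)
  obtain b where b: "b \<in> Arr C" "Dom C b = B" "Cod C b = X" "e \<cdot> b = f \<cdot> j"
    by (rule projectiveD [OF assms(3), of e "f \<cdot> j"]) (use A in auto)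
  have "e \<cdot> Add C (a \<cdot> p) (b \<cdot> q) = Add C ((e \<cdot> a) \<cdot> p) ((e \<cdot> b) \<cdot> q)"
    using A a(1-3) b(1-3) by simp
  also have "\<dots> = f" unfolding a b by (rule biproduct_decomp_from [OF bp]) (use A in auto)
  finally show "\<exists>h \<in> Hom C S X. e \<cdot> h = f"
    using A a b by (intro bexI [of _ "Add C (a \<cdot> p) (b \<cdot> q)"]) auto
qed

text \<open>A split short exact sequence is a biproduct: if \<open>e s = 1\<close>, then \<open>e (1 - s e) = 0\<close>, so that
  \<open>1 - s e\<close> factors through the kernel \<open>k\<close> of \<open>e\<close>, and the factor \<open>r\<close> is the missing projection.\<close>

lemma split_kernel_biproduct:
  assumes ker: "is_kernel C k e" and [simp]: "s \<in> Arr C" "Dom C s = Cod C e" "Cod C s = Dom C e"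
    and es: "e \<cdot> s = Ide C (Cod C e)"
  obtains r where "biproduct C (Dom C e) (Dom C k) (Cod C e) k s r e"
proof -
  note [simp] = is_kernel_simps [OF ker]
  \<comment> \<open>\<open>d = 1 - s e\<close>\<close>
  obtain d where d [simp]: "d \<in> Arr C" "Dom C d = Dom C e" "Cod C d = Dom C e"
      and d_add: "Add C d (s \<cdot> e) = Ide C (Dom C e)"
    by (rule ex_difference [of "Ide C (Dom C e)" "s \<cdot> e"]) auto
  have ese: "e \<cdot> (s \<cdot> e) = e" using Comp_eq_reassoc [OF es, of e] by simp
  have "Add C (e \<cdot> d) e = Add C (Zero C (Dom C e) (Cod C e)) e"
    using arg_cong [OF d_add, of "\<lambda>x. e \<cdot> x"] ese by simp
  then have ed: "e \<cdot> d = Zero C (Dom C d) (Cod C e)"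
    by (auto intro!: Add_right_cancel [of "e \<cdot> d" _ e])
  obtain r where r [simp]: "r \<in> Arr C" "Dom C r = Dom C e" "Cod C r = Dom C k" "k \<cdot> r = d"
    by (rule is_kernel_factor [OF ker, of d]) (use ed in auto)
  have dk: "d \<cdot> k = k"
    using arg_cong [OF d_add, of "\<lambda>x. x \<cdot> k"] by simp
  have "Add C (d \<cdot> s) s = Add C (Zero C (Dom C s) (Dom C e)) s"
    using arg_cong [OF d_add, of "\<lambda>x. x \<cdot> s"] es by simp
  then have ds: "d \<cdot> s = Zero C (Dom C s) (Dom C e)"
    by (auto intro!: Add_right_cancel [of "d \<cdot> s" _ s])
  have "r \<cdot> k = Ide C (Dom C k)"
    by (rule mono_arrD [OF is_kernel_mono [OF ker]]) (use dk Comp_eq_reassoc [OF r(4), of k] in simp_all)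
  moreover have "r \<cdot> s = Zero C (Cod C e) (Dom C k)"
    by (rule mono_arrD [OF is_kernel_mono [OF ker]]) (use ds Comp_eq_reassoc [OF r(4), of s] in simp_all)
  ultimately have "biproduct C (Dom C e) (Dom C k) (Cod C e) k s r e"
    by (simp add: biproduct_def es d_add)
  with that show ?thesis .
qed


lemma biproduct_reassoc:
  assumes bp: "biproduct C S A B i j p q" and f: "f \<in> Arr C"
  shows "Cod C f = A \<Longrightarrow> p \<cdot> (i \<cdot> f) = f"
    "Cod C f = B \<Longrightarrow> q \<cdot> (j \<cdot> f) = f"
    "Cod C f = A \<Longrightarrow> q \<cdot> (i \<cdot> f) = Zero C (Dom C f) B"
    "Cod C f = B \<Longrightarrow> p \<cdot> (j \<cdot> f) = Zero C (Dom C f) A"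
proof -
  note b [simp] = biproduct_simps [OF bp]
  show "Cod C f = A \<Longrightarrow> p \<cdot> (i \<cdot> f) = f"
    using f by (subst Comp_eq_reassoc [OF b(14)]) simp_all
  show "Cod C f = B \<Longrightarrow> q \<cdot> (j \<cdot> f) = f"
    using f by (subst Comp_eq_reassoc [OF b(15)]) simp_all
  show "Cod C f = A \<Longrightarrow> q \<cdot> (i \<cdot> f) = Zero C (Dom C f) B"
    using f by (subst Comp_eq_reassoc [OF b(16)]) simp_all
  show "Cod C f = B \<Longrightarrow> p \<cdot> (j \<cdot> f) = Zero C (Dom C f) A"
    using f by (subst Comp_eq_reassoc [OF b(17)]) simp_all
qed

lemma mono_arr_Zero:
  assumes "mono_arr C f" "x \<in> Arr C" "Cod C x = Dom C f" "f \<cdot> x = Zero C (Dom C x) (Cod C f)"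
  shows "x = Zero C (Dom C x) (Dom C f)"
proof -
  have [simp]: "f \<in> Arr C" using assms(1) by (simp add: mono_arr_def)
  show ?thesis by (rule mono_arrD [OF assms(1)]) (use assms(2-) in simp_all)
qed

lemma epi_arr_Zero:
  assumes "epi_arr C f" "x \<in> Arr C" "Dom C x = Cod C f" "x \<cdot> f = Zero C (Dom C f) (Cod C x)"
  shows "x = Zero C (Cod C f) (Cod C x)"
proof -
  have [simp]: "f \<in> Arr C" using assms(1) by (simp add: epi_arr_def)
  show ?thesis by (rule epi_arrD [OF assms(1)]) (use assms(2-) in simp_all)
qed

lemma mono_arr_Comp:
  assumes "mono_arr C f" "mono_arr C g" "Dom C g = Cod C f"
  shows "mono_arr C (g \<cdot> f)"
proof (rule mono_arrI)
  have [simp]: "f \<in> Arr C" "g \<in> Arr C" using assms by (simp_all add: mono_arr_def)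
  show "g \<cdot> f \<in> Arr C" using assms(3) by simp
  fix x assume x: "x \<in> Arr C" "Cod C x = Dom C (g \<cdot> f)"
    "(g \<cdot> f) \<cdot> x = Zero C (Dom C x) (Cod C (g \<cdot> f))"
  then have "f \<cdot> x = Zero C (Dom C x) (Cod C f)"
    using mono_arr_Zero [OF assms(2), of "f \<cdot> x"] assms(3) by simp
  then show "x = Zero C (Dom C x) (Dom C (g \<cdot> f))"
    using mono_arr_Zero [OF assms(1), of x] x assms(3) by simp
qed

lemma mono_arr_right_factor:
  assumes "mono_arr C (g \<cdot> f)" and [simp]: "f \<in> Arr C" "g \<in> Arr C" "Dom C g = Cod C f"
  shows "mono_arr C f"
proof (rule mono_arrI)
  fix x assume x: "x \<in> Arr C" "Cod C x = Dom C f" "f \<cdot> x = Zero C (Dom C x) (Cod C f)"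
  then show "x = Zero C (Dom C x) (Dom C f)"
    using mono_arr_Zero [OF assms(1), of x] by simp
qed simp

lemma is_kernel_mono_Comp:
  assumes k: "mono_arr C k" and [simp]: "f \<in> Arr C" "Cod C f = Dom C k"
  shows "is_kernel C m (k \<cdot> f) \<longleftrightarrow> is_kernel C m f"
proof -
  have [simp]: "k \<in> Arr C" using k by (simp add: mono_arr_def)
  have *: "k \<cdot> (f \<cdot> x) = Zero C (Dom C x) (Cod C k) \<longleftrightarrow> f \<cdot> x = Zero C (Dom C x) (Dom C k)"
    if "x \<in> Arr C" "Cod C x = Dom C f" for x
    using mono_arr_Zero [OF k, of "f \<cdot> x"] that by auto
  show ?thesis
  proof
    assume m: "is_kernel C m (k \<cdot> f)"
    note [simp] = is_kernel_simps(1,3) [OF m]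
    show "is_kernel C m f"
    proof (rule is_kernelI [OF is_kernel_mono [OF m]])
      show "f \<cdot> m = Zero C (Dom C m) (Cod C f)" using is_kernel_simps(4) [OF m] * by simp
      fix x assume x: "x \<in> Arr C" "Cod C x = Dom C f" "f \<cdot> x = Zero C (Dom C x) (Cod C f)"
      obtain h where "h \<in> Arr C" "Dom C h = Dom C x" "Cod C h = Dom C m" "m \<cdot> h = x"
        by (rule is_kernel_factor [OF m, of x]) (use x in simp_all)
      then show "\<exists>h \<in> Hom C (Dom C x) (Dom C m). m \<cdot> h = x" by auto
    qed simp_all
  next
    assume m: "is_kernel C m f"
    note [simp] = is_kernel_simps [OF m]
    show "is_kernel C m (k \<cdot> f)"
    proof (rule is_kernelI [OF is_kernel_mono [OF m]])
      fix x assume x: "x \<in> Arr C" "Cod C x = Dom C (k \<cdot> f)"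
        "(k \<cdot> f) \<cdot> x = Zero C (Dom C x) (Cod C (k \<cdot> f))"
      obtain h where "h \<in> Arr C" "Dom C h = Dom C x" "Cod C h = Dom C m" "m \<cdot> h = x"
        by (rule is_kernel_factor [OF m, of x]) (use x * in simp_all)
      then show "\<exists>h \<in> Hom C (Dom C x) (Dom C m). m \<cdot> h = x" by auto
    qed simp_all
  qed
qed

lemma zero_object_arr:
  assumes "zero_object C Z" "f \<in> Arr C"
  shows "Dom C f = Z \<Longrightarrow> f = Zero C Z (Cod C f)" "Cod C f = Z \<Longrightarrow> f = Zero C (Dom C f) Z"
proof -
  have [simp]: "Z \<in> Obj C" using assms by (simp add: zero_object_def)
  show "f = Zero C Z (Cod C f)" if "Dom C f = Z"
  proof -
    have "\<exists>!h. h \<in> Hom C Z (Cod C f)" using assms by (simp add: zero_object_def)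
    moreover have "f \<in> Hom C Z (Cod C f)" "Zero C Z (Cod C f) \<in> Hom C Z (Cod C f)"
      using assms(2) that by simp_all
    ultimately show ?thesis by blast
  qed
  show "f = Zero C (Dom C f) Z" if "Cod C f = Z"
  proof -
    have "\<exists>!h. h \<in> Hom C (Dom C f) Z" using assms by (simp add: zero_object_def)
    moreover have "f \<in> Hom C (Dom C f) Z" "Zero C (Dom C f) Z \<in> Hom C (Dom C f) Z"
      using assms(2) that by simp_all
    ultimately show ?thesis by blast
  qed
qed

end

section \<open>Exactness in an abelian category\<close>

context abelian_category
begin

text \<open>An epimorphism is a cokernel of some \<open>t\<close>. If it is also mono, then \<open>t = 0\<close>, and the identity
  factors through it.\<close>

lemma mono_epi_iso:
  assumes "mono_arr C f" "epi_arr C f"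
  obtains g where "g \<in> Arr C" "Dom C g = Cod C f" "Cod C g = Dom C f"
    "g \<cdot> f = Ide C (Dom C f)" "f \<cdot> g = Ide C (Cod C f)"
proof -
  have [simp]: "f \<in> Arr C" using assms by (simp add: mono_arr_def)
  obtain t where t: "is_cokernel C f t" using epi_is_cokernel assms(2) by blast
  note [simp] = is_cokernel_simps [OF t]
  have "t = Zero C (Dom C t) (Dom C f)"
    using mono_arr_Zero [OF assms(1), of t] by simp
  then have idt: "Ide C (Dom C f) \<cdot> t = Zero C (Dom C t) (Dom C f)" by simp
  obtain g where g [simp]: "g \<in> Arr C" "Dom C g = Cod C f" "Cod C g = Dom C f"
      and gf: "g \<cdot> f = Ide C (Dom C f)"
    by (rule is_cokernel_factor [OF t, of "Ide C (Dom C f)"]) (use idt in simp_all)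
  have "f \<cdot> g = Ide C (Cod C f)"
    by (rule epi_arrD [OF assms(2)]) (simp_all add: gf)
  with g gf that show ?thesis by blast
qed

text \<open>If \<open>x h = 0\<close> and \<open>y\<close> is a kernel of \<open>x\<close>, then \<open>f\<close> factors through the subobject \<open>m y\<close> of
  its image. A monomorphism is a kernel, so \<open>m y\<close> is the kernel of some \<open>t\<close>; this \<open>t\<close> kills \<open>f\<close>, hence
  factors through the cokernel of \<open>f\<close> and kills all of \<open>m\<close>. Thus \<open>m\<close> factors through \<open>m y\<close>,
  which makes \<open>y\<close> split epi and \<open>x = 0\<close>.\<close>

lemma epi_onto_image:
  assumes c: "is_cokernel C c f" and m: "is_kernel C m c" and [simp]: "h \<in> Arr C" "Cod C h = Dom C m"
    and mh: "m \<cdot> h = f"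
  shows "epi_arr C h"
proof (rule epi_arrI)
  note [simp] = is_cokernel_simps(1,3) [OF c] is_kernel_simps [OF m]
  fix x assume x [simp]: "x \<in> Arr C" "Dom C x = Cod C h"
    and xh: "x \<cdot> h = Zero C (Dom C h) (Cod C x)"
  obtain y where y: "is_kernel C y x" using ex_kernel x(1) by blast
  note ys [simp] = is_kernel_simps [OF y]
  obtain z where z [simp]: "z \<in> Arr C" "Dom C z = Dom C h" "Cod C z = Dom C y" and yz: "y \<cdot> z = h"
    by (rule is_kernel_factor [OF y, of h]) (use xh in simp_all)
  have "mono_arr C (m \<cdot> y)"
    by (rule mono_arr_Comp [OF is_kernel_mono [OF y] is_kernel_mono [OF m]]) simp
  then obtain t where t: "is_kernel C (m \<cdot> y) t" using mono_is_kernel by blast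
  have ts [simp]: "t \<in> Arr C" "Dom C t = Cod C m"
    using is_kernel_simps [OF t] by simp_all
  have tmy: "t \<cdot> (m \<cdot> y) = Zero C (Dom C y) (Cod C t)" using is_kernel_simps(4) [OF t] by simp
  have f: "f = (m \<cdot> y) \<cdot> z" using mh yz by simp
  have "t \<cdot> f = (t \<cdot> (m \<cdot> y)) \<cdot> z" unfolding f by simp
  also have "\<dots> = Zero C (Dom C f) (Cod C t)" unfolding tmy using mh by auto
  finally have tf: "t \<cdot> f = Zero C (Dom C f) (Cod C t)" .
  have "Cod C f = Cod C m" using mh by auto
  then obtain t' where t' [simp]: "t' \<in> Arr C" "Dom C t' = Cod C c" "Cod C t' = Cod C t" and t'c: "t' \<cdot> c = t"
    using is_cokernel_factor [OF c, of t] tf ts by metis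
  have "t \<cdot> m = t' \<cdot> (c \<cdot> m)" unfolding t'c [symmetric] by (rule Comp_reassoc) simp_all
  also have "\<dots> = Zero C (Dom C m) (Cod C t)" by simp
  finally obtain w where w [simp]: "w \<in> Arr C" "Dom C w = Dom C m" "Cod C w = Dom C (m \<cdot> y)"
      and "(m \<cdot> y) \<cdot> w = m"
    using is_kernel_factor [OF t, of m] by auto
  then have "m \<cdot> (y \<cdot> w) = m" by simp
  then have yw: "y \<cdot> w = Ide C (Dom C m)"
    by (intro mono_arrD [OF is_kernel_mono [OF m], of "y \<cdot> w"]) simp_all
  have "x = x \<cdot> (y \<cdot> w)" by (simp add: yw)
  also have "\<dots> = Zero C (Cod C h) (Cod C x)"
    using Comp_eq_reassoc [OF ys(4), of w] by simp
  finally show "x = Zero C (Cod C h) (Cod C x)" .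
qed simp

text \<open>This form of exactness no longer mentions cokernels. In the backward direction, a
  cokernel \<open>c\<close> of \<open>m h\<close> also kills \<open>m\<close> because \<open>h\<close> is epi, and \<open>g\<close> factors through \<open>c\<close>; so \<open>c\<close>
  and \<open>g\<close> have the same kernel.\<close>

lemma exact_pair_iff:
  "exact_pair C f g \<longleftrightarrow>
    (\<exists>m h. is_kernel C m g \<and> epi_arr C h \<and> Cod C h = Dom C m \<and> f = m \<cdot> h)"
proof
  assume "exact_pair C f g"
  then obtain m c where [simp]: "f \<in> Arr C" and c: "is_cokernel C c f" and m: "is_kernel C m c"
      and mg: "is_kernel C m g"
    unfolding exact_pair_def is_image_def by blast
  obtain h where "h \<in> Arr C" "Dom C h = Dom C f" "Cod C h = Dom C m" "m \<cdot> h = f"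
    by (rule is_kernel_factor [OF m, of f]) (use is_cokernel_simps [OF c] in simp_all)
  with epi_onto_image [OF c m] mg
  show "\<exists>m h. is_kernel C m g \<and> epi_arr C h \<and> Cod C h = Dom C m \<and> f = m \<cdot> h" by blast
next
  assume "\<exists>m h. is_kernel C m g \<and> epi_arr C h \<and> Cod C h = Dom C m \<and> f = m \<cdot> h"
  then obtain m h where m: "is_kernel C m g" and h: "epi_arr C h" and [simp]: "Cod C h = Dom C m"
      and f: "f = m \<cdot> h"
    by blast
  note [simp] = is_kernel_simps [OF m]
  have [simp]: "h \<in> Arr C" using h by (simp add: epi_arr_def)
  have "m \<cdot> h \<in> Arr C" by simp
  then obtain c where c: "is_cokernel C c (m \<cdot> h)" using ex_cokernel by blast
  have [simp]: "c \<in> Arr C" "Dom C c = Cod C m" using is_cokernel_simps [OF c] by simp_all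
  have cmh: "c \<cdot> (m \<cdot> h) = Zero C (Dom C h) (Cod C c)" using is_cokernel_simps(4) [OF c] by simp
  have gmh: "g \<cdot> (m \<cdot> h) = Zero C (Dom C h) (Cod C g)"
    using Comp_eq_reassoc [OF is_kernel_simps(4) [OF m], of h] by simp
  obtain g' where g' [simp]: "g' \<in> Arr C" "Dom C g' = Cod C c" "Cod C g' = Cod C g"
      and g'c: "g' \<cdot> c = g"
    by (rule is_cokernel_factor [OF c, of g]) (use gmh in simp_all)
  have "is_kernel C m c"
  proof (rule is_kernelI [OF is_kernel_mono [OF m]])
    show "c \<cdot> m = Zero C (Dom C m) (Cod C c)"
      using epi_arr_Zero [OF h, of "c \<cdot> m"] cmh by simp
    fix x assume x: "x \<in> Arr C" "Cod C x = Dom C c" "c \<cdot> x = Zero C (Dom C x) (Cod C c)"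
    have "g \<cdot> x = g' \<cdot> (c \<cdot> x)"
      using Comp_eq_reassoc [OF g'c, of x] x(1,2) by simp
    then have gx: "g \<cdot> x = Zero C (Dom C x) (Cod C g)" using x by simp
    obtain a where "a \<in> Arr C" "Dom C a = Dom C x" "Cod C a = Dom C m" "m \<cdot> a = x"
      by (rule is_kernel_factor [OF m, of x]) (use x(1,2) gx in simp_all)
    then show "\<exists>a \<in> Hom C (Dom C x) (Dom C m). m \<cdot> a = x" by auto
  qed simp_all
  with c m show "exact_pair C f g"
    unfolding exact_pair_def is_image_def f by auto
qed

lemma exact_Zero_left_iff:
  assumes Z: "zero_object C Z" and [simp]: "f \<in> Arr C"
  shows "exact_pair C (Zero C Z (Dom C f)) f \<longleftrightarrow> mono_arr C f"
proof
  have [simp]: "Z \<in> Obj C" using Z by (simp add: zero_object_def)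
  {
    assume "exact_pair C (Zero C Z (Dom C f)) f"
    then obtain m h where m: "is_kernel C m f" and h: "epi_arr C h" and hm [simp]: "Cod C h = Dom C m"
        and eq: "Zero C Z (Dom C f) = m \<cdot> h"
      unfolding exact_pair_iff by blast
    note [simp] = is_kernel_simps [OF m]
    have [simp]: "h \<in> Arr C" using h by (simp add: epi_arr_def)
    have "Dom C h = Z" using arg_cong [OF eq, of "Dom C"] by simp
    then have "h = Zero C Z (Dom C m)" using zero_object_arr(1) [OF Z, of h] by simp
    then have m0: "Ide C (Dom C m) = Zero C (Dom C m) (Dom C m)"
      using epi_arr_Zero [OF h, of "Ide C (Dom C m)"] \<open>Dom C h = Z\<close> by simp
    have y0: "y = Zero C (Dom C y) (Dom C m)" if "y \<in> Arr C" "Cod C y = Dom C m" for y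
    proof -
      have "Ide C (Dom C m) \<cdot> y = Zero C (Dom C y) (Dom C m)"
        unfolding m0 using that by simp
      then show ?thesis using that by simp
    qed
    show "mono_arr C f"
    proof (rule mono_arrI)
      fix x assume x: "x \<in> Arr C" "Cod C x = Dom C f" "f \<cdot> x = Zero C (Dom C x) (Cod C f)"
      obtain y where y: "y \<in> Arr C" "Dom C y = Dom C x" "Cod C y = Dom C m" "m \<cdot> y = x"
        by (rule is_kernel_factor [OF m, of x]) (use x in simp_all)
      have "y = Zero C (Dom C x) (Dom C m)" using y0 [of y] y(1-3) by simp
      then have "x = m \<cdot> Zero C (Dom C x) (Dom C m)" using y(4) by simp
      then show "x = Zero C (Dom C x) (Dom C f)" using x(1) by simp
    qed simp
  }
  {
    assume f: "mono_arr C f"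
    have "is_kernel C (Zero C Z (Dom C f)) f"
    proof (rule is_kernelI)
      show "mono_arr C (Zero C Z (Dom C f))"
        by (rule mono_arrI) (use zero_object_arr(2) [OF Z] in simp_all)
      fix x assume x: "x \<in> Arr C" "Cod C x = Dom C f" "f \<cdot> x = Zero C (Dom C x) (Cod C f)"
      then show "\<exists>h \<in> Hom C (Dom C x) (Dom C (Zero C Z (Dom C f))). Zero C Z (Dom C f) \<cdot> h = x"
        using mono_arr_Zero [OF f, of x]
        by (intro bexI [of _ "Zero C (Dom C x) Z"]) simp_all
    qed simp_all
    moreover have "epi_arr C (Ide C Z)" by (rule split_epi_arr [of _ "Ide C Z"]) simp_all
    ultimately show "exact_pair C (Zero C Z (Dom C f)) f"
      unfolding exact_pair_iff
      by (intro exI [of _ "Zero C Z (Dom C f)"] exI [of _ "Ide C Z"]) simp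
  }
qed

lemma exact_Zero_right_iff:
  assumes Z: "zero_object C Z" and [simp]: "f \<in> Arr C"
  shows "exact_pair C f (Zero C (Cod C f) Z) \<longleftrightarrow> epi_arr C f"
proof
  have [simp]: "Z \<in> Obj C" using Z by (simp add: zero_object_def)
  {
    assume "exact_pair C f (Zero C (Cod C f) Z)"
    then obtain m h where m: "is_kernel C m (Zero C (Cod C f) Z)" and h: "epi_arr C h"
        and [simp]: "Cod C h = Dom C m" and f: "f = m \<cdot> h"
      unfolding exact_pair_iff by blast
    have [simp]: "m \<in> Arr C" "Cod C m = Cod C f" using is_kernel_simps [OF m] by simp_all
    obtain w where w: "w \<in> Arr C" "Dom C w = Cod C f" "Cod C w = Dom C m" "m \<cdot> w = Ide C (Cod C f)"
      by (rule is_kernel_factor [OF m, of "Ide C (Cod C f)"]) simp_all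
    have "epi_arr C m" by (rule split_epi_arr [of _ w]) (use w in simp_all)
    with h show "epi_arr C f" unfolding f by (intro epi_arr_Comp) simp_all
  }
  {
    assume f: "epi_arr C f"
    have "is_kernel C (Ide C (Cod C f)) (Zero C (Cod C f) Z)"
    proof (rule is_kernelI)
      show "mono_arr C (Ide C (Cod C f))" by (rule mono_arrI) simp_all
      fix x assume x: "x \<in> Arr C" "Cod C x = Dom C (Zero C (Cod C f) Z)"
      then show "\<exists>h \<in> Hom C (Dom C x) (Dom C (Ide C (Cod C f))). Ide C (Cod C f) \<cdot> h = x"
        by (intro bexI [of _ x]) simp_all
    qed simp_all
    with f show "exact_pair C f (Zero C (Cod C f) Z)"
      unfolding exact_pair_iff
      by (intro exI [of _ "Ide C (Cod C f)"] exI [of _ f]) simp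
  }
qed

text \<open>This is what permits a long exact sequence to be cut at a syzygy, and two sequences to be
  spliced there: a differential may be replaced by its corestriction to the syzygy.\<close>

lemma exact_pair_mono_Comp:
  assumes "mono_arr C k" "g \<in> Arr C" "Cod C g = Dom C k"
  shows "exact_pair C f (k \<cdot> g) \<longleftrightarrow> exact_pair C f g"
  unfolding exact_pair_iff is_kernel_mono_Comp [OF assms] ..

lemma short_exact_iff: "short_exact C f g \<longleftrightarrow> is_kernel C f g \<and> epi_arr C g"
proof
  assume "short_exact C f g"
  then obtain Z where Z: "zero_object C Z" and e1: "exact_pair C (Zero C Z (Dom C f)) f"
      and e2: "exact_pair C f g" and e3: "exact_pair C g (Zero C (Cod C g) Z)"
    unfolding short_exact_def by blast
  have [simp]: "f \<in> Arr C" "g \<in> Arr C" using e2 by (simp_all add: exact_pair_def)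
  have f: "mono_arr C f" and g: "epi_arr C g"
    using e1 e3 by (simp_all add: exact_Zero_left_iff [OF Z] exact_Zero_right_iff [OF Z])
  from e2 obtain m h where m: "is_kernel C m g" and h: "epi_arr C h" and [simp]: "Cod C h = Dom C m"
      and fm: "f = m \<cdot> h"
    unfolding exact_pair_iff by blast
  note ms [simp] = is_kernel_simps [OF m]
  have [simp]: "h \<in> Arr C" using h by (simp add: epi_arr_def)
  have "mono_arr C h"
    by (rule mono_arr_right_factor [of m]) (use f in \<open>simp_all add: fm\<close>)
  then obtain h' where h' [simp]: "h' \<in> Arr C" "Dom C h' = Dom C m" "Cod C h' = Dom C h"
      and hh': "h \<cdot> h' = Ide C (Dom C m)"
    using mono_epi_iso [OF _ h] by auto
  have "is_kernel C f g"
    unfolding fm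
  proof (rule is_kernelI)
    show "mono_arr C (m \<cdot> h)" using f fm by simp
    show "g \<cdot> (m \<cdot> h) = Zero C (Dom C (m \<cdot> h)) (Cod C g)"
      using Comp_eq_reassoc [OF ms(4), of h] by simp
    fix x assume x: "x \<in> Arr C" "Cod C x = Dom C g" "g \<cdot> x = Zero C (Dom C x) (Cod C g)"
    obtain y where y [simp]: "y \<in> Arr C" "Dom C y = Dom C x" "Cod C y = Dom C m" and my: "m \<cdot> y = x"
      by (rule is_kernel_factor [OF m, of x]) (use x in simp_all)
    have "h \<cdot> (h' \<cdot> y) = y" using Comp_eq_reassoc [OF hh', of y] by simp
    then have "(m \<cdot> h) \<cdot> (h' \<cdot> y) = x" by (simp add: my)
    then show "\<exists>a \<in> Hom C (Dom C x) (Dom C (m \<cdot> h)). (m \<cdot> h) \<cdot> a = x"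
      by (intro bexI [of _ "h' \<cdot> y"]) simp_all
  qed simp_all
  with g show "is_kernel C f g \<and> epi_arr C g" by simp
next
  assume A: "is_kernel C f g \<and> epi_arr C g"
  then have f: "is_kernel C f g" and g: "epi_arr C g" by simp_all
  note [simp] = is_kernel_simps [OF f]
  obtain Z where Z: "zero_object C Z" using ex_zero_object by blast
  have "epi_arr C (Ide C (Dom C f))" by (rule split_epi_arr [of _ "Ide C (Dom C f)"]) simp_all
  with f have "exact_pair C f g"
    unfolding exact_pair_iff by (intro exI [of _ f] exI [of _ "Ide C (Dom C f)"]) simp
  with Z is_kernel_mono [OF f] g show "short_exact C f g"
    unfolding short_exact_def
    by (intro exI [of _ Z]) (simp add: exact_Zero_left_iff [OF Z] exact_Zero_right_iff [OF Z])
qed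

end

section \<open>Syzygies and Schanuel's lemma\<close>

fun pd_at_most :: "('o, 'm, 'x) preadditive_data_scheme \<Rightarrow> nat \<Rightarrow> 'o \<Rightarrow> bool"
  where "pd_at_most C 0 A \<longleftrightarrow> projective C A"
  | "pd_at_most C (Suc n) A \<longleftrightarrow> (\<exists>k e. short_exact C k e \<and> Cod C e = A \<and>
      projective C (Dom C e) \<and> pd_at_most C n (Dom C k))"

context abelian_category
begin

lemma short_exact_simps:
  assumes "short_exact C k e"
  shows "k \<in> Arr C" "e \<in> Arr C" "Cod C k = Dom C e" "e \<cdot> k = Zero C (Dom C k) (Cod C e)"
    "is_kernel C k e" "epi_arr C e" "mono_arr C k"
  using assms is_kernel_simps [of k e] is_kernel_mono [of k e] by (simp_all add: short_exact_iff)

text \<open>Write \<open>K \<rightarrow> P \<rightarrow> A\<close> and \<open>K' \<rightarrow> P' \<rightarrow> A\<close> for the two sequences. The common biproduct is the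
  pullback of \<open>e\<close> and \<open>e'\<close>; each of its projections to \<open>P\<close> and \<open>P'\<close> splits by projectivity, with
  kernels \<open>K'\<close> and \<open>K\<close>. The pullback need not be constructed: \<open>X = K' \<oplus> P\<close> serves, with the lift
  \<open>h: P \<rightarrow> P'\<close> of \<open>e\<close> defining the projection \<open>\<pi> = (k', h): X \<rightarrow> P'\<close>. With a lift \<open>h': P' \<rightarrow> P\<close> of \<open>e'\<close>, a
  section \<open>s\<close> of \<open>\<pi>\<close> has the components \<open>1 - h h'\<close> (read as a map to \<open>K'\<close>) and \<open>h'\<close>, and a kernel \<open>\<iota>\<close> has
  the components \<open>- h k\<close> (likewise) and \<open>k\<close>.\<close>

lemma schanuel:
  assumes ex: "short_exact C k e" and ex': "short_exact C k' e'"
    and cod [simp]: "Cod C e = Cod C e'"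
    and P: "projective C (Dom C e)" and P': "projective C (Dom C e')"
  obtains X i j p q i' j' p' q' where
    "biproduct C X (Dom C k') (Dom C e) i j p q"
    "biproduct C X (Dom C k) (Dom C e') i' j' p' q'"
proof -
  note e [simp] = short_exact_simps(1-3) [OF ex] and e' [simp] = short_exact_simps(1-3) [OF ex']
  have ek: "e \<cdot> k = Zero C (Dom C k) (Cod C e')" using short_exact_simps(4) [OF ex] by simp
  note e'k' = short_exact_simps(4) [OF ex']
  have "has_biproduct C (Dom C k') (Dom C e)" by (rule ex_biproduct) simp_all
  then obtain X i j p q where bp: "biproduct C X (Dom C k') (Dom C e) i j p q"
    unfolding has_biproduct_def biproduct_def by blast
  note [simp] = biproduct_simps [OF bp] biproduct_reassoc [OF bp]
  obtain h where h [simp]: "h \<in> Arr C" "Dom C h = Dom C e" "Cod C h = Dom C e'" and e'h: "e' \<cdot> h = e"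
    by (rule projectiveD [OF P short_exact_simps(6) [OF ex'], of e]) simp_all
  obtain h' where h' [simp]: "h' \<in> Arr C" "Dom C h' = Dom C e'" "Cod C h' = Dom C e" and eh': "e \<cdot> h' = e'"
    by (rule projectiveD [OF P' short_exact_simps(6) [OF ex], of e']) simp_all
  \<comment> \<open>\<open>d = 1 - h h'\<close> is killed by \<open>e'\<close>, and \<open>u\<close> is its corestriction to \<open>k'\<close>\<close>
  obtain d where d [simp]: "d \<in> Arr C" "Dom C d = Dom C e'" "Cod C d = Dom C e'"
      and d_add: "Add C d (h \<cdot> h') = Ide C (Dom C e')"
    by (rule ex_difference [of "Ide C (Dom C e')" "h \<cdot> h'"]) simp_all
  have e'hx: "e' \<cdot> (h \<cdot> x) = e \<cdot> x" if "x \<in> Arr C" "Cod C x = Dom C e" for x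
    using Comp_eq_reassoc [OF e'h, of x] that by simp
  have "Add C (e' \<cdot> d) e' = e' \<cdot> Add C d (h \<cdot> h')" by (simp add: e'hx eh')
  also have "\<dots> = Add C (Zero C (Dom C e') (Cod C e')) e'" unfolding d_add by simp
  finally have e'd: "e' \<cdot> d = Zero C (Dom C e') (Cod C e')"
    by (rule Add_right_cancel [rotated 7]) simp_all
  obtain u where u [simp]: "u \<in> Arr C" "Dom C u = Dom C e'" "Cod C u = Dom C k'" and k'u: "k' \<cdot> u = d"
    by (rule is_kernel_factor [OF short_exact_simps(5) [OF ex'], of d]) (use e'd in simp_all)
  \<comment> \<open>\<open>d' = - h k\<close>, with corestriction \<open>w\<close>\<close>
  obtain d' where d' [simp]: "d' \<in> Arr C" "Dom C d' = Dom C k" "Cod C d' = Dom C e'"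
      and d'_add: "Add C d' (h \<cdot> k) = Zero C (Dom C k) (Dom C e')"
    by (rule ex_difference [of "Zero C (Dom C k) (Dom C e')" "h \<cdot> k"]) simp_all
  have "e' \<cdot> d' = e' \<cdot> Add C d' (h \<cdot> k)" by (simp add: e'hx ek)
  then have e'd': "e' \<cdot> d' = Zero C (Dom C k) (Cod C e')" unfolding d'_add by simp
  obtain w where w [simp]: "w \<in> Arr C" "Dom C w = Dom C k" "Cod C w = Dom C k'" and k'w: "k' \<cdot> w = d'"
    by (rule is_kernel_factor [OF short_exact_simps(5) [OF ex'], of d']) (use e'd' in simp_all)
  define \<pi> where "\<pi> = Add C (k' \<cdot> p) (h \<cdot> q)"
  define s where "s = Add C (i \<cdot> u) (j \<cdot> h')"
  define \<iota> where "\<iota> = Add C (i \<cdot> w) (j \<cdot> k)"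
  have [simp]: "\<pi> \<in> Arr C" "Dom C \<pi> = X" "Cod C \<pi> = Dom C e'"
    "s \<in> Arr C" "Dom C s = Dom C e'" "Cod C s = X"
    "\<iota> \<in> Arr C" "Dom C \<iota> = Dom C k" "Cod C \<iota> = X"
    by (simp_all add: \<pi>_def s_def \<iota>_def)
  have "\<pi> \<cdot> s = Ide C (Cod C \<pi>)"
    using d_add by (simp add: \<pi>_def s_def k'u)
  moreover have "is_kernel C \<iota> \<pi>"
  proof (rule is_kernelI)
    show "mono_arr C \<iota>"
    proof (rule mono_arrI)
      fix x assume x: "x \<in> Arr C" "Cod C x = Dom C \<iota>" "\<iota> \<cdot> x = Zero C (Dom C x) (Cod C \<iota>)"
      have "k \<cdot> x = q \<cdot> (\<iota> \<cdot> x)" using x(1,2) by (simp add: \<iota>_def)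
      then have "k \<cdot> x = Zero C (Dom C x) (Cod C k)" unfolding x(3) using x(1) by simp
      then show "x = Zero C (Dom C x) (Dom C \<iota>)"
        using mono_arr_Zero [OF short_exact_simps(7) [OF ex], of x] x(1,2) by simp
    qed simp
    show "\<pi> \<cdot> \<iota> = Zero C (Dom C \<iota>) (Cod C \<pi>)"
      using d'_add by (simp add: \<pi>_def \<iota>_def k'w)
    fix f assume f: "f \<in> Arr C" "Cod C f = Dom C \<pi>" "\<pi> \<cdot> f = Zero C (Dom C f) (Cod C \<pi>)"
    have \<pi>f: "Add C (k' \<cdot> (p \<cdot> f)) (h \<cdot> (q \<cdot> f)) = Zero C (Dom C f) (Dom C e')"
      using f by (simp add: \<pi>_def)
    have "e \<cdot> (q \<cdot> f) = e' \<cdot> Add C (k' \<cdot> (p \<cdot> f)) (h \<cdot> (q \<cdot> f))"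
      using f(1,2) Comp_eq_reassoc [OF e'k', of "p \<cdot> f"] by (simp add: e'hx)
    then have eqf: "e \<cdot> (q \<cdot> f) = Zero C (Dom C f) (Cod C e')" unfolding \<pi>f using f(1) by simp
    obtain a where a [simp]: "a \<in> Arr C" "Dom C a = Dom C f" "Cod C a = Dom C k" and ka: "k \<cdot> a = q \<cdot> f"
      by (rule is_kernel_factor [OF short_exact_simps(5) [OF ex], of "q \<cdot> f"]) (use f(1,2) eqf in simp_all)
    have "Add C (k' \<cdot> (w \<cdot> a)) (h \<cdot> (q \<cdot> f)) = Add C d' (h \<cdot> k) \<cdot> a"
      using Comp_eq_reassoc [OF k'w, of a] by (simp add: ka)
    also have "\<dots> = Add C (k' \<cdot> (p \<cdot> f)) (h \<cdot> (q \<cdot> f))"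
      unfolding \<pi>f d'_add by simp
    finally have "k' \<cdot> (w \<cdot> a) = k' \<cdot> (p \<cdot> f)"
      by (rule Add_right_cancel [rotated 7]) (use f(1,2) in simp_all)
    then have "w \<cdot> a = p \<cdot> f"
      by (rule mono_arrD [OF short_exact_simps(7) [OF ex'], rotated 5]) (use f(1,2) in simp_all)
    then have "\<iota> \<cdot> a = Add C (i \<cdot> (p \<cdot> f)) (j \<cdot> (q \<cdot> f))" by (simp add: \<iota>_def ka)
    also have "\<dots> = f" by (rule biproduct_decomp_to [OF bp]) (use f(1,2) in simp_all)
    finally show "\<exists>h \<in> Hom C (Dom C f) (Dom C \<iota>). \<iota> \<cdot> h = f"
      by (intro bexI [of _ a]) simp_all
  qed simp_all
  ultimately obtain r where "biproduct C (Dom C \<pi>) (Dom C \<iota>) (Cod C \<pi>) \<iota> s r \<pi>"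
    using split_kernel_biproduct [of \<iota> \<pi> s] by auto
  then have "biproduct C X (Dom C k) (Dom C e') \<iota> s r \<pi>" by simp
  with bp that show ?thesis by blast
qed

text \<open>Adding \<open>Q\<close> to the first two terms of \<open>0 \<rightarrow> K \<rightarrow> R \<rightarrow> A \<rightarrow> 0\<close> gives the sequence
  \<open>0 \<rightarrow> K \<rightarrow> R \<oplus> Q \<rightarrow> A \<oplus> Q \<rightarrow> 0\<close> with the same kernel, so no induction is needed.\<close>

lemma pd_at_most_biproduct:
  assumes "pd_at_most C n A" and bp: "biproduct C X A Q i j p q" and Q: "projective C Q"
  shows "pd_at_most C n X"
proof (cases n)
  case 0
  with assms show ?thesis by (simp add: projective_biproduct [OF bp])
next
  case (Suc l)
  with assms obtain k e where ex: "short_exact C k e" and [simp]: "Cod C e = A"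
      and R: "projective C (Dom C e)" and k: "pd_at_most C l (Dom C k)"
    by auto
  note [simp] = short_exact_simps(1-3) [OF ex]
  have ek: "e \<cdot> k = Zero C (Dom C k) A" using short_exact_simps(4) [OF ex] by simp
  note [simp] = biproduct_simps [OF bp] biproduct_reassoc [OF bp]
  have "has_biproduct C (Dom C e) Q" by (rule ex_biproduct) simp_all
  then obtain Y i' j' p' q' where bp': "biproduct C Y (Dom C e) Q i' j' p' q'"
    unfolding has_biproduct_def biproduct_def by blast
  note [simp] = biproduct_simps [OF bp'] biproduct_reassoc [OF bp']
  define \<epsilon> where "\<epsilon> = Add C (i \<cdot> (e \<cdot> p')) (j \<cdot> q')"
  have [simp]: "\<epsilon> \<in> Arr C" "Dom C \<epsilon> = Y" "Cod C \<epsilon> = X" by (simp_all add: \<epsilon>_def)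
  have \<epsilon>i: "\<epsilon> \<cdot> i' = i \<cdot> e" and \<epsilon>j: "\<epsilon> \<cdot> j' = j" by (simp_all add: \<epsilon>_def)
  have "epi_arr C \<epsilon>"
  proof (rule epi_arrI)
    fix x assume x: "x \<in> Arr C" "Dom C x = Cod C \<epsilon>" "x \<cdot> \<epsilon> = Zero C (Dom C \<epsilon>) (Cod C x)"
    have "(x \<cdot> i) \<cdot> e = Zero C (Dom C e) (Cod C x)"
      using Comp_eq_reassoc [OF x(3), of i'] x(1,2) by (simp add: \<epsilon>i)
    then have xi: "x \<cdot> i = Zero C A (Cod C x)"
      using epi_arr_Zero [OF short_exact_simps(6) [OF ex], of "x \<cdot> i"] x(1,2) by simp
    have xj: "x \<cdot> j = Zero C Q (Cod C x)"
      using Comp_eq_reassoc [OF x(3), of j'] x(1,2) by (simp add: \<epsilon>j)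
    have "x = Add C ((x \<cdot> i) \<cdot> p) ((x \<cdot> j) \<cdot> q)"
      by (rule biproduct_decomp_from [OF bp, symmetric]) (use x in simp_all)
    also have "\<dots> = Zero C (Cod C \<epsilon>) (Cod C x)" unfolding xi xj using x(1) by simp
    finally show "x = Zero C (Cod C \<epsilon>) (Cod C x)" .
  qed simp
  moreover have "is_kernel C (i' \<cdot> k) \<epsilon>"
  proof (rule is_kernelI)
    show "mono_arr C (i' \<cdot> k)"
    proof (rule mono_arrI)
      fix x assume x: "x \<in> Arr C" "Cod C x = Dom C (i' \<cdot> k)" "(i' \<cdot> k) \<cdot> x = Zero C (Dom C x) (Cod C (i' \<cdot> k))"
      have "k \<cdot> x = p' \<cdot> ((i' \<cdot> k) \<cdot> x)" using x(1,2) by simp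
      then have "k \<cdot> x = Zero C (Dom C x) (Cod C k)" unfolding x(3) using x(1) by simp
      then show "x = Zero C (Dom C x) (Dom C (i' \<cdot> k))"
        using mono_arr_Zero [OF short_exact_simps(7) [OF ex], of x] x(1,2) by simp
    qed simp
    show "\<epsilon> \<cdot> (i' \<cdot> k) = Zero C (Dom C (i' \<cdot> k)) (Cod C \<epsilon>)"
      using Comp_eq_reassoc [OF \<epsilon>i, of k] by (simp add: ek)
    fix f assume f: "f \<in> Arr C" "Cod C f = Dom C \<epsilon>" "\<epsilon> \<cdot> f = Zero C (Dom C f) (Cod C \<epsilon>)"
    have "e \<cdot> (p' \<cdot> f) = p \<cdot> (\<epsilon> \<cdot> f)" using f(1,2) by (simp add: \<epsilon>_def)
    then have epf: "e \<cdot> (p' \<cdot> f) = Zero C (Dom C f) A" unfolding f(3) using f(1) by simp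
    have "q' \<cdot> f = q \<cdot> (\<epsilon> \<cdot> f)" using f(1,2) by (simp add: \<epsilon>_def)
    then have qf: "q' \<cdot> f = Zero C (Dom C f) Q" unfolding f(3) using f(1) by simp
    obtain a where a [simp]: "a \<in> Arr C" "Dom C a = Dom C f" "Cod C a = Dom C k" and ka: "k \<cdot> a = p' \<cdot> f"
      by (rule is_kernel_factor [OF short_exact_simps(5) [OF ex], of "p' \<cdot> f"]) (use f(1,2) epf in simp_all)
    have "(i' \<cdot> k) \<cdot> a = Add C (i' \<cdot> (p' \<cdot> f)) (j' \<cdot> (q' \<cdot> f))"
      unfolding qf using f(1,2) by (simp add: ka)
    also have "\<dots> = f" by (rule biproduct_decomp_to [OF bp']) (use f(1,2) in simp_all)
    finally show "\<exists>h \<in> Hom C (Dom C f) (Dom C (i' \<cdot> k)). (i' \<cdot> k) \<cdot> h = f"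
      by (intro bexI [of _ a]) simp_all
  qed simp_all
  ultimately have "short_exact C (i' \<cdot> k) \<epsilon>" by (simp add: short_exact_iff)
  moreover have "projective C Y" by (rule projective_biproduct [OF bp' R Q])
  ultimately show ?thesis
    unfolding Suc pd_at_most.simps using k by (intro exI [of _ "i' \<cdot> k"] exI [of _ \<epsilon>]) simp
qed

text \<open>Given \<open>0 \<rightarrow> M \<rightarrow> R \<rightarrow> A \<oplus> Q \<rightarrow> 0\<close>, let \<open>N\<close> be the kernel of the composite \<open>R \<rightarrow> A \<oplus> Q \<rightarrow> A\<close>. It is an
  extension of \<open>Q\<close> by \<open>M\<close>, which splits because \<open>Q\<close> is projective. Hence \<open>N\<close> is a biproduct of \<open>M\<close>
  and \<open>Q\<close> and is controlled by the preceding lemma, and \<open>0 \<rightarrow> N \<rightarrow> R \<rightarrow> A \<rightarrow> 0\<close> is a first step for \<open>A\<close>.\<close>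

lemma pd_at_most_summand:
  assumes "pd_at_most C n X" and bp: "biproduct C X A Q i j p q" and Q: "projective C Q"
  shows "pd_at_most C n A"
proof (cases n)
  case 0
  with assms biproduct_simps [OF bp] projective_retract [of X i p] show ?thesis by simp
next
  case (Suc l)
  with assms obtain m r where ex: "short_exact C m r" and [simp]: "Cod C r = X"
      and R: "projective C (Dom C r)" and m: "pd_at_most C l (Dom C m)"
    by auto
  note [simp] = short_exact_simps(1-3) [OF ex]
  have rm: "r \<cdot> m = Zero C (Dom C m) X" using short_exact_simps(4) [OF ex] by simp
  note [simp] = biproduct_simps [OF bp] biproduct_reassoc [OF bp]
  have "p \<cdot> r \<in> Arr C" by simp
  then obtain \<kappa> where \<kappa>: "is_kernel C \<kappa> (p \<cdot> r)" using ex_kernel by blast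
  have [simp]: "\<kappa> \<in> Arr C" "Cod C \<kappa> = Dom C r" using is_kernel_simps [OF \<kappa>] by simp_all
  have pr\<kappa>: "p \<cdot> (r \<cdot> \<kappa>) = Zero C (Dom C \<kappa>) A" using is_kernel_simps(4) [OF \<kappa>] by simp
  have "epi_arr C p" by (rule split_epi_arr [of _ i]) simp_all
  then have "epi_arr C (p \<cdot> r)" by (intro epi_arr_Comp short_exact_simps(6) [OF ex]) simp_all
  with \<kappa> have ex': "short_exact C \<kappa> (p \<cdot> r)" by (simp add: short_exact_iff)
  \<comment> \<open>a section \<open>t'\<close> of \<open>N \<rightarrow> Q\<close>: the inclusion \<open>j\<close> lifts along \<open>r\<close>, and the lift lands in \<open>N\<close> as \<open>p j = 0\<close>\<close>
  obtain t where t [simp]: "t \<in> Arr C" "Dom C t = Q" "Cod C t = Dom C r" and rt: "r \<cdot> t = j"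
    by (rule projectiveD [OF Q short_exact_simps(6) [OF ex], of j]) simp_all
  obtain t' where t' [simp]: "t' \<in> Arr C" "Dom C t' = Q" "Cod C t' = Dom C \<kappa>" and \<kappa>t': "\<kappa> \<cdot> t' = t"
    by (rule is_kernel_factor [OF \<kappa>, of t]) (simp_all add: rt)
  obtain m' where m' [simp]: "m' \<in> Arr C" "Dom C m' = Dom C m" "Cod C m' = Dom C \<kappa>" and \<kappa>m': "\<kappa> \<cdot> m' = m"
    by (rule is_kernel_factor [OF \<kappa>, of m]) (simp_all add: rm)
  define g where "g = q \<cdot> (r \<cdot> \<kappa>)"
  have [simp]: "g \<in> Arr C" "Dom C g = Dom C \<kappa>" "Cod C g = Q" by (simp_all add: g_def)
  have "g \<cdot> t' = Ide C (Cod C g)" by (simp add: g_def \<kappa>t' rt)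
  moreover have "is_kernel C m' g"
  proof (rule is_kernelI)
    show "mono_arr C m'"
      by (rule mono_arr_right_factor [of \<kappa>]) (use short_exact_simps(7) [OF ex] in \<open>simp_all add: \<kappa>m'\<close>)
    show "g \<cdot> m' = Zero C (Dom C m') (Cod C g)" by (simp add: g_def \<kappa>m' rm)
    fix f assume f: "f \<in> Arr C" "Cod C f = Dom C g" "g \<cdot> f = Zero C (Dom C f) (Cod C g)"
    have qf: "q \<cdot> (r \<cdot> (\<kappa> \<cdot> f)) = Zero C (Dom C f) Q" using f by (simp add: g_def)
    have pf: "p \<cdot> (r \<cdot> (\<kappa> \<cdot> f)) = Zero C (Dom C f) A"
      using Comp_eq_reassoc [OF pr\<kappa>, of f] f(1,2) by simp
    have "r \<cdot> (\<kappa> \<cdot> f) = Add C (i \<cdot> (p \<cdot> (r \<cdot> (\<kappa> \<cdot> f)))) (j \<cdot> (q \<cdot> (r \<cdot> (\<kappa> \<cdot> f))))"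
      by (rule biproduct_decomp_to [OF bp, symmetric]) (use f(1,2) in simp_all)
    then have rf: "r \<cdot> (\<kappa> \<cdot> f) = Zero C (Dom C f) X" unfolding qf pf using f(1) by simp
    obtain a where a [simp]: "a \<in> Arr C" "Dom C a = Dom C f" "Cod C a = Dom C m" and ma: "m \<cdot> a = \<kappa> \<cdot> f"
      by (rule is_kernel_factor [OF short_exact_simps(5) [OF ex], of "\<kappa> \<cdot> f"]) (use f(1,2) rf in simp_all)
    have "\<kappa> \<cdot> (m' \<cdot> a) = \<kappa> \<cdot> f" using Comp_eq_reassoc [OF \<kappa>m', of a] by (simp add: ma)
    then have "m' \<cdot> a = f"
      by (rule mono_arrD [OF is_kernel_mono [OF \<kappa>], rotated 5]) (use f(1,2) in simp_all)
    then show "\<exists>h \<in> Hom C (Dom C f) (Dom C m'). m' \<cdot> h = f"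
      by (intro bexI [of _ a]) simp_all
  qed simp_all
  ultimately obtain s where "biproduct C (Dom C g) (Dom C m') (Cod C g) m' t' s g"
    using split_kernel_biproduct [of m' g t'] by auto
  then have "biproduct C (Dom C \<kappa>) (Dom C m) Q m' t' s g" by simp
  then have "pd_at_most C l (Dom C \<kappa>)" using pd_at_most_biproduct m Q by blast
  with ex' R show ?thesis
    unfolding Suc pd_at_most.simps by (intro exI [of _ \<kappa>] exI [of _ "p \<cdot> r"]) simp
qed

text \<open>Schanuel's lemma gives \<open>K' \<oplus> P \<cong> K \<oplus> P'\<close>, and the two preceding lemmas transfer the bound from
  \<open>K\<close> to the right-hand side and from the left-hand side to \<open>K'\<close>.\<close>

lemma pd_at_most_kernel:
  assumes "pd_at_most C (Suc n) A" and ex': "short_exact C k' e'" and "Cod C e' = A"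
    and P': "projective C (Dom C e')"
  shows "pd_at_most C n (Dom C k')"
proof -
  obtain k e where ex: "short_exact C k e" and "Cod C e = Cod C e'"
      and P: "projective C (Dom C e)" and k: "pd_at_most C n (Dom C k)"
    using assms(1,3) by auto
  then obtain X i j p q i' j' p' q' where bp: "biproduct C X (Dom C k') (Dom C e) i j p q"
      and bp': "biproduct C X (Dom C k) (Dom C e') i' j' p' q'"
    using schanuel [OF ex ex' _ P P'] by blast
  show ?thesis
    by (rule pd_at_most_summand [OF pd_at_most_biproduct [OF k bp' P'] bp P])
qed

section \<open>Long resolutions and syzygies\<close>

lemma exact_pair_epi_factor:
  assumes "exact_pair C f g" and "epi_arr C g"
  obtains k h where "short_exact C k g" "epi_arr C h" "Cod C h = Dom C k" "Dom C h = Dom C f" "f = k \<cdot> h"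
proof -
  obtain k h where k: "is_kernel C k g" and h: "epi_arr C h" "Cod C h = Dom C k" and f: "f = k \<cdot> h"
    using assms(1) unfolding exact_pair_iff by blast
  moreover have "Dom C h = Dom C f"
    using is_kernel_simps(1) [OF k] h by (simp add: f epi_arr_def)
  ultimately show ?thesis using assms(2) that by (simp add: short_exact_iff)
qed

text \<open>From left to right in the step, the resolution loses its augmentation, and \<open>d 1\<close>,
  corestricted to the kernel of \<open>d 0\<close>, becomes the new one; from right to left, the augmentation
  \<open>d 0\<close> of the syzygy is composed with \<open>k\<close>.\<close>

lemma resolution_of_length_iff:
  "has_projective_resolution_of_length C A n \<longleftrightarrow> pd_at_most C n A"
proof (induction n arbitrary: A)
  case 0
  show ?case
  proof
    assume "has_projective_resolution_of_length C A 0"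
    then obtain P d Z where Z: "zero_object C Z" and P: "projective C P"
        and d [simp]: "d \<in> Arr C" "Dom C d = P" "Cod C d = A"
        and left: "exact_pair C (Zero C Z P) d" and right: "exact_pair C d (Zero C A Z)"
      unfolding has_projective_resolution_of_length_def by auto
    have "mono_arr C d" "epi_arr C d"
      using left right exact_Zero_left_iff [OF Z, of d] exact_Zero_right_iff [OF Z, of d] by simp_all
    then obtain g where g: "g \<in> Arr C" "Dom C g = A" "Cod C g = P" "d \<cdot> g = Ide C A"
      by (rule mono_epi_iso) simp
    then show "pd_at_most C 0 A"
      using projective_retract [OF P, of g d] by simp
  next
    assume "pd_at_most C 0 A"
    then have A: "projective C A" and [simp]: "A \<in> Obj C" by (simp_all add: projective_def)
    obtain Z where Z: "zero_object C Z" using ex_zero_object by blast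
    have "mono_arr C (Ide C A)" by (rule mono_arrI) simp_all
    moreover have "epi_arr C (Ide C A)" by (rule split_epi_arr [of _ "Ide C A"]) simp_all
    ultimately show "has_projective_resolution_of_length C A 0"
      unfolding has_projective_resolution_of_length_def
      using Z A exact_Zero_left_iff [OF Z, of "Ide C A"] exact_Zero_right_iff [OF Z, of "Ide C A"]
      by (intro exI [of _ "\<lambda>_. A"] exI [of _ "\<lambda>_. Ide C A"] exI [of _ Z]) simp
  qed
next
  case (Suc n)
  show ?case
  proof
    assume "has_projective_resolution_of_length C A (Suc n)"
    then obtain P d Z where Z: "zero_object C Z" and P: "\<And>i. i \<le> Suc n \<Longrightarrow> projective C (P i)"
        and d0: "d 0 \<in> Hom C (P 0) A" and d: "\<And>i. i < Suc n \<Longrightarrow> d (Suc i) \<in> Hom C (P (Suc i)) (P i)"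
        and left: "exact_pair C (Zero C Z (P (Suc n))) (d (Suc n))"
        and ex: "\<And>i. i < Suc n \<Longrightarrow> exact_pair C (d (Suc i)) (d i)"
        and right: "exact_pair C (d 0) (Zero C A Z)"
      unfolding has_projective_resolution_of_length_def by auto
    have "epi_arr C (d 0)" using right d0 exact_Zero_right_iff [OF Z, of "d 0"] by simp
    moreover have "exact_pair C (d 1) (d 0)" "Dom C (d 1) = P 1" using ex [of 0] d [of 0] by simp_all
    ultimately obtain k h where k: "short_exact C k (d 0)" and h: "epi_arr C h"
        and kh: "Cod C h = Dom C k" "Dom C h = P 1" "d 1 = k \<cdot> h"
      by (metis exact_pair_epi_factor)
    have [simp]: "h \<in> Arr C" using h by (simp add: epi_arr_def)
    have ex1: "exact_pair C f h" if "exact_pair C f (d 1)" for f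
      using that exact_pair_mono_Comp [OF short_exact_simps(7) [OF k], of h] kh by simp
    define d' where "d' = (\<lambda>i. if i = 0 then h else d (Suc i))"
    have "has_projective_resolution_of_length C (Dom C k) n"
      unfolding has_projective_resolution_of_length_def
    proof (intro exI conjI allI impI)
      show "zero_object C Z" by (rule Z)
      show "projective C (P (Suc i))" if "i \<le> n" for i using P that by simp
      show "d' 0 \<in> Hom C (P (Suc 0)) (Dom C k)" using kh by (simp add: d'_def)
      show "d' (Suc i) \<in> Hom C (P (Suc (Suc i))) (P (Suc i))" if "i < n" for i
        using d [of "Suc i"] that by (simp add: d'_def)
      show "exact_pair C (Zero C Z (P (Suc n))) (d' n)"
        using left ex1 by (cases n) (simp_all add: d'_def)
      show "exact_pair C (d' (Suc i)) (d' i)" if "i < n" for i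
        using ex [of "Suc i"] ex1 that by (cases i) (simp_all add: d'_def)
      show "exact_pair C (d' 0) (Zero C (Dom C k) Z)"
        using exact_Zero_right_iff [OF Z, of h] h kh(1) by (simp add: d'_def)
    qed
    with Suc k P [of 0] d0 show "pd_at_most C (Suc n) A"
      unfolding pd_at_most.simps by (intro exI [of _ k] exI [of _ "d 0"]) simp
  next
    assume "pd_at_most C (Suc n) A"
    then obtain k e where k: "short_exact C k e" and [simp]: "Cod C e = A" and Pe: "projective C (Dom C e)"
        and "has_projective_resolution_of_length C (Dom C k) n"
      using Suc by auto
    then obtain P d Z where Z: "zero_object C Z" and P: "\<And>i. i \<le> n \<Longrightarrow> projective C (P i)"
        and d0: "d 0 \<in> Hom C (P 0) (Dom C k)" and d: "\<And>i. i < n \<Longrightarrow> d (Suc i) \<in> Hom C (P (Suc i)) (P i)"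
        and left: "exact_pair C (Zero C Z (P n)) (d n)"
        and ex: "\<And>i. i < n \<Longrightarrow> exact_pair C (d (Suc i)) (d i)"
        and right: "exact_pair C (d 0) (Zero C (Dom C k) Z)"
      unfolding has_projective_resolution_of_length_def by auto
    note [simp] = short_exact_simps(1-3) [OF k]
    have "epi_arr C (d 0)" using right d0 exact_Zero_right_iff [OF Z, of "d 0"] by simp
    then have ex0: "exact_pair C (k \<cdot> d 0) e"
      using short_exact_simps(5) [OF k] d0 unfolding exact_pair_iff by auto
    have ex1: "exact_pair C f (k \<cdot> d 0)" if "exact_pair C f (d 0)" for f
      using that exact_pair_mono_Comp [OF short_exact_simps(7) [OF k], of "d 0"] d0 by simp
    define P' where "P' = case_nat (Dom C e) P"
    define d' where "d' = case_nat e (case_nat (k \<cdot> d 0) (\<lambda>i. d (Suc i)))"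
    show "has_projective_resolution_of_length C A (Suc n)"
      unfolding has_projective_resolution_of_length_def
    proof (intro exI conjI allI impI)
      show "zero_object C Z" by (rule Z)
      show "projective C (P' i)" if "i \<le> Suc n" for i
        using P Pe that by (cases i) (simp_all add: P'_def)
      show "d' 0 \<in> Hom C (P' 0) A" by (simp add: d'_def P'_def)
      show "d' (Suc i) \<in> Hom C (P' (Suc i)) (P' i)" if "i < Suc n" for i
        using d [of "i - 1"] d0 that by (cases i) (simp_all add: d'_def P'_def)
      show "exact_pair C (Zero C Z (P' (Suc n))) (d' (Suc n))"
        using left ex1 by (cases n) (simp_all add: d'_def P'_def)
      show "exact_pair C (d' (Suc i)) (d' i)" if "i < Suc n" for i
        using ex [of "i - 1"] ex0 ex1 that by (auto simp: d'_def split: nat.split)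
      show "exact_pair C (d' 0) (Zero C A Z)"
        using exact_Zero_right_iff [OF Z, of e] short_exact_simps(6) [OF k] by (simp add: d'_def)
    qed
  qed
qed

lemma dp_eq: "dp C A = Inf {enat n | n. pd_at_most C n A}"
  by (simp add: dp_def resolution_of_length_iff)

lemma projective_resolution_syzygy:
  assumes "has_projective_resolution C A"
  obtains k e where "short_exact C k e" "Cod C e = A" "projective C (Dom C e)"
    "has_projective_resolution C (Dom C k)"
proof -
  obtain P d Z where Z: "zero_object C Z" and P: "\<And>i. projective C (P i)"
      and d0: "d 0 \<in> Hom C (P 0) A" and d: "\<And>i. d (Suc i) \<in> Hom C (P (Suc i)) (P i)"
      and ex: "\<And>i. exact_pair C (d (Suc i)) (d i)" and right: "exact_pair C (d 0) (Zero C A Z)"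
    using assms unfolding has_projective_resolution_def by auto
  have "epi_arr C (d 0)" using right d0 exact_Zero_right_iff [OF Z, of "d 0"] by simp
  moreover have "exact_pair C (d 1) (d 0)" "Dom C (d 1) = P 1" using ex [of 0] d [of 0] by simp_all
  ultimately obtain k h where k: "short_exact C k (d 0)" and h: "epi_arr C h"
      and kh: "Cod C h = Dom C k" "Dom C h = P 1" "d 1 = k \<cdot> h"
    by (metis exact_pair_epi_factor)
  have [simp]: "h \<in> Arr C" using h by (simp add: epi_arr_def)
  have ex1: "exact_pair C (d (Suc 1)) h"
    using ex [of 1] exact_pair_mono_Comp [OF short_exact_simps(7) [OF k], of h] kh by simp
  define d' where "d' = (\<lambda>i. if i = 0 then h else d (Suc i))"
  have "has_projective_resolution C (Dom C k)"
    unfolding has_projective_resolution_def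
  proof (intro exI conjI allI)
    show "zero_object C Z" by (rule Z)
    show "projective C (P (Suc i))" for i by (rule P)
    show "d' 0 \<in> Hom C (P (Suc 0)) (Dom C k)" using kh by (simp add: d'_def)
    show "d' (Suc i) \<in> Hom C (P (Suc (Suc i))) (P (Suc i))" for i
      using d [of "Suc i"] by (simp add: d'_def)
    show "exact_pair C (d' (Suc i)) (d' i)" for i
      using ex [of "Suc i"] ex1 by (cases i) (simp_all add: d'_def)
    show "exact_pair C (d' 0) (Zero C (Dom C k) Z)"
      using exact_Zero_right_iff [OF Z, of h] h kh(1) by (simp add: d'_def)
  qed
  with that [OF k] P [of 0] d0 show ?thesis by simp
qed

lemma dp_eq_0_iff: "dp C A = 0 \<longleftrightarrow> projective C A"
proof
  assume "projective C A"
  then have "enat 0 \<in> {enat n | n. pd_at_most C n A}" by force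
  then have "dp C A \<le> enat 0" unfolding dp_eq by (rule Inf_lower)
  then show "dp C A = 0" by (simp add: zero_enat_def [symmetric])
next
  assume 0: "dp C A = 0"
  have "\<exists>n. pd_at_most C n A"
  proof (rule ccontr)
    assume "\<nexists>n. pd_at_most C n A"
    then have "dp C A = \<infinity>" by (simp add: dp_eq Inf_enat_def)
    with 0 show False by simp
  qed
  then have "Inf {enat n | n. pd_at_most C n A} \<in> {enat n | n. pd_at_most C n A}"
    unfolding Inf_enat_def using LeastI_ex [of "\<lambda>x. x \<in> {enat n | n. pd_at_most C n A}"] by auto
  then show "projective C A" using 0 unfolding dp_eq [symmetric] by (auto simp: zero_enat_def)
qed

end

section \<open>Exact functors\<close>

context exact_functor
begin

lemma short_exact_image:
  assumes "short_exact C k e"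
  shows "short_exact D (farr F k) (farr F e)"
    "Dom D (farr F k) = fobj F (Dom C k)"
    "Dom D (farr F e) = fobj F (Dom C e)" "Cod D (farr F e) = fobj F (Cod C e)"
proof -
  have "k \<in> Arr C" "e \<in> Arr C"
    using assms by (auto simp: short_exact_def exact_pair_def)
  then show "Dom D (farr F k) = fobj F (Dom C k)"
    "Dom D (farr F e) = fobj F (Dom C e)" "Cod D (farr F e) = fobj F (Cod C e)"
    using farr_Hom [of k "Dom C k" "Cod C k"] farr_Hom [of e "Dom C e" "Cod C e"] by simp_all
  show "short_exact D (farr F k) (farr F e)" by (rule farr_short_exact [OF assms])
qed

lemma pd_at_most_image:
  assumes "respects_projectivity C D F"
  shows "pd_at_most C n A \<Longrightarrow> pd_at_most D n (fobj F A)"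
proof (induction n arbitrary: A)
  case 0
  then show ?case using assms by (simp add: respects_projectivity_def projective_def)
next
  case (Suc n)
  then obtain k e where k: "short_exact C k e" and "Cod C e = A"
      and "projective C (Dom C e)" "pd_at_most D n (fobj F (Dom C k))"
    by auto
  moreover from this have "projective D (fobj F (Dom C e))"
    using assms by (simp add: respects_projectivity_def projective_def)
  ultimately show ?case
    unfolding pd_at_most.simps using short_exact_image [OF k]
    by (intro exI [of _ "farr F k"] exI [of _ "farr F e"]) simp
qed

text \<open>The induction runs along the syzygies of the given resolution of \<open>A\<close>. Their images are kernels
  of epimorphisms from projective objects, so \<open>pd_at_most_kernel\<close> lowers the bound by one at
  each step until the image, and hence the syzygy itself, is projective.\<close>

lemma pd_at_most_reflect:
  assumes "abelian_category C" "abelian_category D"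
    and resp: "respects_projectivity C D F" and refl: "reflects_projectivity C D F"
  shows "A \<in> Obj C \<Longrightarrow> has_projective_resolution C A \<Longrightarrow> pd_at_most D n (fobj F A) \<Longrightarrow> pd_at_most C n A"
proof (induction n arbitrary: A)
  case 0
  then show ?case using refl by (simp add: reflects_projectivity_def)
next
  case (Suc n)
  interpret C: abelian_category C by fact
  interpret D: abelian_category D by fact
  obtain k e where k: "short_exact C k e" and e: "Cod C e = A" and P: "projective C (Dom C e)"
      and K: "has_projective_resolution C (Dom C k)"
    using C.projective_resolution_syzygy [OF Suc.prems(2)] by blast
  have "projective D (fobj F (Dom C e))"
    using P resp by (simp add: respects_projectivity_def projective_def)
  then have "pd_at_most D n (fobj F (Dom C k))"
    using D.pd_at_most_kernel [OF Suc.prems(3) short_exact_image(1) [OF k]] short_exact_image(2-4) [OF k] e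
    by simp
  then have "pd_at_most C n (Dom C k)"
    using Suc.IH [OF _ K] C.short_exact_simps(1) [OF k] by simp
  with k e P show ?case by auto
qed

end

theorem mainTheorem10:
  fixes C :: "('o, 'm) preadditive_data"
    and D :: "('p, 'n) preadditive_data"
    and F :: "('o, 'm, 'p, 'n) functor_data"
  assumes "abelian_category C" and "abelian_category D" and "exact_functor C D F"
  shows "(respects_projectivity C D F \<longleftrightarrow> (\<forall>A \<in> Obj C. dp C A \<ge> dp D (fobj F A))) \<and>
    (\<forall>A \<in> Obj C. has_projective_resolution C A \<and>
        respects_projectivity C D F \<and> reflects_projectivity C D F \<longrightarrow>
      dp C A = dp D (fobj F A))"
proof -
  interpret C: abelian_category C by fact
  interpret D: abelian_category D by fact
  interpret exact_functor C D F by fact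
  have le: "dp D (fobj F A) \<le> dp C A" if "respects_projectivity C D F" for A
    unfolding C.dp_eq D.dp_eq
    by (rule Inf_superset_mono) (use pd_at_most_image [OF that] in blast)
  have ge: "dp C A \<le> dp D (fobj F A)"
    if "A \<in> Obj C" "has_projective_resolution C A"
      "respects_projectivity C D F" "reflects_projectivity C D F" for A
    unfolding C.dp_eq D.dp_eq
    by (rule Inf_superset_mono)
      (use pd_at_most_reflect [OF assms(1,2) that(3,4,1,2)] in blast)
  have "respects_projectivity C D F" if A: "\<forall>A \<in> Obj C. dp C A \<ge> dp D (fobj F A)"
    unfolding respects_projectivity_def
  proof (intro ballI impI)
    fix P assume "P \<in> Obj C" "projective C P"
    then have "dp D (fobj F P) \<le> 0" using A C.dp_eq_0_iff [of P] by force
    then show "projective D (fobj F P)" using D.dp_eq_0_iff by simp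
  qed
  with le ge show ?thesis by (blast intro: order.antisym)
qed

end
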